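(* Let $\mathcal H$ and $\mathcal L$ be strictly causal linear operators, let $\mathcal K_0=\mathcal L\mathcal H^\ast(I+\mathcal H\mathcal H^\ast)^{-1}$, and for a linear operator $\mathcal K$ put $T_{\mathcal K}=\begin{pmatrix}\mathcal L-\mathcal K\mathcal H & -\mathcal K\end{pmatrix}$. For $\gamma>0$ let $\Delta$ and $\nabla_\gamma$ be the causal operators obtained from the canonical factorizations $$\Delta\Delta^\ast = I+\mathcal H\mathcal H^\ast,\qquad \nabla_\gamma^\ast\nabla_\gamma=\gamma^{-2}\bigl(I+\gamma^{-2}\mathcal L(I+\mathcal H^\ast\mathcal H)^{-1}\mathcal L^\ast\bigr).$$ (i) A causal operator $\mathcal K$ satisfying $\|T_{\mathcal K}^\ast T_{\mathcal K}-T_{\mathcal K_0}^\ast T_{\mathcal K_0}\|\le\gamma^2$ (a $\gamma$-optimal estimator) exists if and only if $$\min_{\text{causal }\mathcal K'}\bigl\|\{\nabla_\gamma\mathcal K_0\Delta\}_- -\mathcal K'\bigr\|\le 1 .$$ (ii) Let $(\gamma^\ast,\mathcal K')$ be a pair that achieves the upper bound in (i), i.e. $\mathcal K'$ is a causal operator attaining the minimum in (i) for $\gamma=\gamma^\ast$ and this minimum equals $1$. Then $$\mathcal K=\nabla_{\gamma^\ast}^{-1}\bigl(\mathcal K'+\{\nabla_{\gamma^\ast}\mathcal K_0\Delta\}_+\bigr)\Delta^{-1}$$ is a regret-optimal causal estimator, i.e. it attains $\min_{\text{causal }\mathcal K}\|T_{\mathcal K}^\ast T_{\mathcal K}-T_{\mathcal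 K_0}^\ast T_{\mathcal K_0}\|$.
   Context: Linear estimation problem: $\mathbf y=\mathcal H\mathbf w+\mathbf v$, $\mathbf s=\mathcal L\mathbf w$, where $\mathbf w=\{w_i\}$ (disturbance), $\mathbf v=\{v_i\}$ (observation noise), $\mathbf y$ (observations) and $\mathbf s$ (signal to be estimated) are sequences of finite-dimensional vectors indexed by time. Linear operators are viewed as block matrices indexed by time; an operator is causal if it is (block) lower triangular, strictly causal if strictly lower triangular, strictly anticausal if strictly upper triangular. For an operator $\mathcal X$, $\{\mathcal X\}_+$ denotes its causal (lower triangular) part and $\{\mathcal X\}_-$ its strictly anticausal (strictly upper triangular) part. $\|\cdot\|$ is the operator norm (induced by the $\ell_2$ norm) and $^\ast$ is the adjoint. A linear estimator is $\hat{\mathbf s}=\mathcal K\mathbf y$, and its error is $\mathbf s-\hat{\mathbf s}=T_{\mathcal K}\begin{pmatrix}\mathbf w\\ \mathbf v\end{pmatrix}$. In a canonical factorization the factor ($\Delta$, respectively $\nabla_\gamma$) is causal and has a causal inverse. The optimal regret is $\min_{\text{causal }\mathcal K}\|T_{\mathcal K}^\ast T_{\mathcal K}-T_{\mathcal K_0}^\ast T_{\mathcal K_0}\|$. *)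

theory Defs
  imports "HOL-Analysis.Analysis" "HOL-Library.Function_Algebras"
begin

text \<open>
  The index type \<open>'t\<close> is time; it may be finite, one-sided (\<open>nat\<close>) or two-sided (\<open>int\<close>).
  The scalar sort \<open>{real_normed_field, euclidean_space}\<close> covers \<open>real\<close> and \<open>complex\<close>.
  A \<open>('t, 'k, 'm, 'n) block_op\<close> is a block matrix mapping sequences in \<open>'k^'n\<close> to sequences
  in \<open>'k^'m\<close>; it need not be bounded on \<open>\<ell>\<^sub>2\<close>. Sums and differences are entrywise.
\<close>

type_synonym ('t, 'k, 'm, 'n) block_op = "'t \<Rightarrow> 't \<Rightarrow> 'k^'n^'m"

definition l2 :: "('t \<Rightarrow> 'a::real_normed_vector) \<Rightarrow> bool" where
  "l2 x \<longleftrightarrow> (\<lambda>i. (norm (x i))\<^sup>2) summable_on UNIV"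

definition l2norm :: "('t \<Rightarrow> 'a::real_normed_vector) \<Rightarrow> real" where
  "l2norm x = sqrt (\<Sum>\<^sub>\<infinity>i. (norm (x i))\<^sup>2)"

definition op_apply ::
  "('t, 'k::{real_normed_field,euclidean_space}, 'm::finite, 'n::finite) block_op
    \<Rightarrow> ('t \<Rightarrow> 'k^'n) \<Rightarrow> ('t \<Rightarrow> 'k^'m)" where
  "op_apply A x = (\<lambda>i. \<Sum>\<^sub>\<infinity>j. A i j *v x j)"

definition bounded_by ::
  "('t, 'k::{real_normed_field,euclidean_space}, 'm::finite, 'n::finite) block_op
    \<Rightarrow> real \<Rightarrow> bool" where
  "bounded_by A c \<longleftrightarrow>
    (\<forall>x. l2 x \<longrightarrow> (\<forall>i. (\<lambda>j. A i j *v x j) summable_on UNIV)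
      \<and> l2 (op_apply A x) \<and> l2norm (op_apply A x) \<le> c * l2norm x)"

definition bounded_op ::
  "('t, 'k::{real_normed_field,euclidean_space}, 'm::finite, 'n::finite) block_op \<Rightarrow> bool" where
  "bounded_op A \<longleftrightarrow> (\<exists>c. bounded_by A c)"

text \<open>The operator norm on \<open>\<ell>\<^sub>2\<close>; it is \<open>\<infinity>\<close> for a block matrix that is not bounded.\<close>

definition opnorm ::
  "('t, 'k::{real_normed_field,euclidean_space}, 'm::finite, 'n::finite) block_op \<Rightarrow> ennreal" where
  "opnorm A = Inf {ennreal c | c. 0 \<le> c \<and> bounded_by A c}"

definition op_mult ::
  "('t, 'k::{real_normed_field,euclidean_space}, 'm::finite, 'p::finite) block_op
    \<Rightarrow> ('t, 'k, 'p, 'n::finite) block_op \<Rightarrow> ('t, 'k, 'm, 'n) block_op"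
  (infixl "\<odot>" 70) where
  "A \<odot> B = (\<lambda>i j. \<Sum>\<^sub>\<infinity>k. A i k ** B k j)"

definition op_id ::
  "('t, 'k::{real_normed_field,euclidean_space}, 'n::finite, 'n) block_op" where
  "op_id = (\<lambda>i j. if i = j then mat 1 else 0)"

definition op_scale ::
  "real \<Rightarrow> ('t, 'k::{real_normed_field,euclidean_space}, 'm::finite, 'n::finite) block_op
    \<Rightarrow> ('t, 'k, 'm, 'n) block_op" where
  "op_scale c A = (\<lambda>i j. c *\<^sub>R A i j)"

text \<open>Conjugation, written uniformly for real and complex scalars.\<close>

definition scalar_conj :: "'k::real_normed_field \<Rightarrow> 'k" where
  "scalar_conj a = (norm a)\<^sup>2 *\<^sub>R inverse a"

lemma scalar_conj_real: "scalar_conj (a::real) = a"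
  by (cases "a = 0") (simp_all add: scalar_conj_def power2_eq_square)

lemma scalar_conj_complex: "scalar_conj (a::complex) = cnj a"
proof (cases "a = 0")
  case False
  then show ?thesis
    by (simp add: scalar_conj_def scaleR_conv_of_real complex_norm_square mult.assoc
        mult.left_commute[of a] del: of_real_power)
qed (simp add: scalar_conj_def)

definition op_adj ::
  "('t, 'k::{real_normed_field,euclidean_space}, 'm::finite, 'n::finite) block_op
    \<Rightarrow> ('t, 'k, 'n, 'm) block_op" where
  "op_adj A = (\<lambda>i j. \<chi> p q. scalar_conj (A j i $ q $ p))"

definition is_op_inverse ::
  "('t, 'k::{real_normed_field,euclidean_space}, 'n::finite, 'n) block_op
    \<Rightarrow> ('t, 'k, 'n, 'n) block_op \<Rightarrow> bool" where
  "is_op_inverse A B \<longleftrightarrow> bounded_op B \<and> A \<odot> B = op_id \<and> B \<odot> A = op_id"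

definition op_inv ::
  "('t, 'k::{real_normed_field,euclidean_space}, 'n::finite, 'n) block_op
    \<Rightarrow> ('t, 'k, 'n, 'n) block_op" where
  "op_inv A = (THE B. is_op_inverse A B)"

definition causal ::
  "('t::linorder, 'k::{real_normed_field,euclidean_space}, 'm::finite, 'n::finite) block_op
    \<Rightarrow> bool" where
  "causal A \<longleftrightarrow> (\<forall>i j. i < j \<longrightarrow> A i j = 0)"

definition strictly_causal ::
  "('t::linorder, 'k::{real_normed_field,euclidean_space}, 'm::finite, 'n::finite) block_op
    \<Rightarrow> bool" where
  "strictly_causal A \<longleftrightarrow> (\<forall>i j. i \<le> j \<longrightarrow> A i j = 0)"

definition causal_part ::
  "('t::linorder, 'k::{real_normed_field,euclidean_space}, 'm::finite, 'n::finite) block_op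
    \<Rightarrow> ('t, 'k, 'm, 'n) block_op" where
  "causal_part A = (\<lambda>i j. if j \<le> i then A i j else 0)"

definition anticausal_part ::
  "('t::linorder, 'k::{real_normed_field,euclidean_space}, 'm::finite, 'n::finite) block_op
    \<Rightarrow> ('t, 'k, 'm, 'n) block_op" where
  "anticausal_part A = (\<lambda>i j. if i < j then A i j else 0)"

definition canonical_factor ::
  "('t::linorder, 'k::{real_normed_field,euclidean_space}, 'n::finite, 'n) block_op \<Rightarrow> bool" where
  "canonical_factor D \<longleftrightarrow> bounded_op D \<and> causal D \<and> (\<exists>E. causal E \<and> is_op_inverse D E)"

text \<open>
  The block row \<open>(A B)\<close>: a pair of sequences \<open>(w, v)\<close> is identified with the sequence of
  stacked vectors \<open>(w\<^sub>i, v\<^sub>i)\<close>, which is an isometry for the \<open>\<ell>\<^sub>2\<close> norms.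
\<close>

definition block_row ::
  "('t, 'k::{real_normed_field,euclidean_space}, 'm::finite, 'n::finite) block_op
    \<Rightarrow> ('t, 'k, 'm, 'p::finite) block_op \<Rightarrow> ('t, 'k, 'm, 'n + 'p) block_op" where
  "block_row A B =
    (\<lambda>i j. \<chi> a b. case b of Inl p \<Rightarrow> A i j $ a $ p | Inr q \<Rightarrow> B i j $ a $ q)"

definition error_op ::
  "('t, 'k::{real_normed_field,euclidean_space}, 'y::finite, 'w::finite) block_op
    \<Rightarrow> ('t, 'k, 's::finite, 'w) block_op \<Rightarrow> ('t, 'k, 's, 'y) block_op
    \<Rightarrow> ('t, 'k, 's, 'w + 'y) block_op" where
  "error_op H L K = block_row (L - K \<odot> H) (- K)"

definition noncausal_estimator ::
  "('t, 'k::{real_normed_field,euclidean_space}, 'y::finite, 'w::finite) block_op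
    \<Rightarrow> ('t, 'k, 's::finite, 'w) block_op \<Rightarrow> ('t, 'k, 's, 'y) block_op" where
  "noncausal_estimator H L = L \<odot> op_adj H \<odot> op_inv (op_id + H \<odot> op_adj H)"

definition regret ::
  "('t, 'k::{real_normed_field,euclidean_space}, 'y::finite, 'w::finite) block_op
    \<Rightarrow> ('t, 'k, 's::finite, 'w) block_op \<Rightarrow> ('t, 'k, 's, 'y) block_op \<Rightarrow> ennreal" where
  "regret H L K =
    opnorm (op_adj (error_op H L K) \<odot> error_op H L K
      - op_adj (error_op H L (noncausal_estimator H L))
          \<odot> error_op H L (noncausal_estimator H L))"

text \<open>
  Triangular truncation does not preserve boundedness on \<open>\<ell>\<^sub>2\<close>, so the strictly anticausal
  part of a bounded operator may be unbounded. Hence \<open>K'\<close> is allowed below to be any causal block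
  matrix, and the norm takes the value \<open>\<infinity>\<close> unless the difference is bounded.
\<close>

definition nehari_norm ::
  "('t::linorder, 'k::{real_normed_field,euclidean_space}, 'm::finite, 'n::finite) block_op
    \<Rightarrow> ('t, 'k, 'm, 'n) block_op \<Rightarrow> ennreal" where
  "nehari_norm X K' = opnorm (anticausal_part X - K')"

end

theory Submission
  imports Defs
begin

text \<open>
  Write \<open>V = (H I)\<close> and \<open>P = T\<^bsub>K0\<^esub>\<close>. Then \<open>T\<^sub>K = P - M U\<close> with \<open>M = (K - K0) \<Delta>\<close> and the
  coisometry \<open>U = \<Delta>\<^sup>-\<^sup>1 V\<close>, and \<open>K0\<close> is characterised by \<open>P U\<^sup>* = 0\<close>. Hence the regret operator is
  \<open>U\<^sup>* M\<^sup>* M U - U\<^sup>* M\<^sup>* P - P\<^sup>* M U\<close>, where the ranges of \<open>U\<^sup>*\<close> and \<open>P\<^sup>*\<close> are orthogonal. A Schur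
  complement argument shows that its norm is at most \<open>\<gamma>\<^sup>2\<close> iff
  \<open>M\<^sup>* (I + \<gamma>\<^sup>-\<^sup>2 P P\<^sup>*) M \<le> \<gamma>\<^sup>2\<close>. Since \<open>P P\<^sup>* = L (I + H\<^sup>* H)\<^sup>-\<^sup>1 L\<^sup>*\<close>, this says that
  \<open>Nabla M = Nabla K \<Delta> - Nabla K0 \<Delta>\<close> is a contraction. The map sending \<open>K\<close> to \<open>Nabla K \<Delta>\<close> is a
  bijection of the bounded causal operators, so this is a Nehari problem; its minimum exists by weak
  compactness. If the minimum is \<open>1\<close>, a causal estimator of regret at most \<open>\<delta>\<^sup>2 < \<gamma>\<^sup>2\<close> would
  make it at most \<open>\<delta> / \<gamma> < 1\<close>.
\<close>

section \<open>Sequence spaces\<close>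

text \<open>The scalar sort only says that the norm is multiplicative; polarization turns this into
  a rule for the inner product.\<close>

lemma inner_mult_mult_left:
  fixes a b c :: "'k::{real_normed_field,real_inner}"
  shows "inner (a * b) (a * c) = (norm a)\<^sup>2 * inner b c"
proof -
  have "norm (a * b + a * c) = norm a * norm (b + c)"
    by (simp add: norm_mult flip: distrib_left)
  then show ?thesis
    by (simp add: dot_norm norm_mult power_mult_distrib right_diff_distrib)
qed

text \<open>This justifies \<open>scalar_conj\<close> as conjugation: adjoints can be taken for the
  real inner product even over complex scalars. The proof writes \<open>c\<close> as
  \<open>a * (inverse a * c)\<close> and cancels \<open>a\<close>.\<close>

lemma inner_scalar_conj:
  fixes a b c :: "'k::{real_normed_field,real_inner}"
  shows "inner (a * b) c = inner b (scalar_conj a * c)"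
proof (cases "a = 0")
  case False
  then have "inner (a * b) c = inner (a * b) (a * (inverse a * c))"
    by (metis mult.assoc mult_1 right_inverse)
  also have "\<dots> = inner b ((norm a)\<^sup>2 *\<^sub>R (inverse a * c))"
    by (simp only: inner_mult_mult_left inner_scaleR_right)
  finally show ?thesis by (simp add: scalar_conj_def)
qed (simp add: scalar_conj_def)

lemma scalar_conj_scalar_conj: "scalar_conj (scalar_conj a) = (a::'k::real_normed_field)"
proof (cases "a = 0")
  case False
  then have "norm (scalar_conj a) = norm a"
    by (simp add: scalar_conj_def norm_inverse power2_eq_square)
  moreover have "inverse (scalar_conj a) = inverse ((norm a)\<^sup>2) *\<^sub>R a"
    using False by (simp add: scalar_conj_def inverse_scaleR_distrib)
  ultimately show ?thesis
    using False by (subst scalar_conj_def) simp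
qed (simp add: scalar_conj_def)

definition mat_adj ::
    "('k::{real_normed_field,euclidean_space})^'n::finite^'m::finite \<Rightarrow> 'k^'m^'n" where
  "mat_adj M = (\<chi> p q. scalar_conj (M $ q $ p))"

lemma op_adj_apply: "op_adj A i j = mat_adj (A j i)"
  by (simp add: op_adj_def mat_adj_def)

lemma inner_mat_adj: "inner (M *v x) y = inner x (mat_adj M *v y)"
  by (simp add: inner_vec_def matrix_vector_mult_def mat_adj_def inner_sum_left inner_sum_right
      inner_scalar_conj) (rule sum.swap)

lemma mat_adj_mat_adj [simp]: "mat_adj (mat_adj M) = M"
  by (simp add: mat_adj_def scalar_conj_scalar_conj vec_eq_iff)

lemma matrix_vector_ext:
  fixes M N :: "('k::comm_semiring_1)^'n^'m"
  assumes "\<And>x. M *v x = N *v x" shows "M = N"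
  using assms matrix_eq by blast

lemma bounded_linear_matrix_vector_left:
  fixes x :: "('k::{real_normed_field,euclidean_space})^'n::finite"
  shows "bounded_linear (\<lambda>M :: 'k^'n^'m::finite. M *v x)"
  by (rule linear_conv_bounded_linear[THEN iffD1], rule linearI)
    (simp_all add: matrix_vector_mult_add_rdistrib matrix_vector_mult_def vec_eq_iff scaleR_sum_right sum.distrib
      distrib_right)

lemma bounded_linear_matrix_vector_right:
  fixes M :: "('k::{real_normed_field,euclidean_space})^'n::finite^'m::finite"
  shows "bounded_linear (\<lambda>x. M *v x)"
  by (rule linear_conv_bounded_linear[THEN iffD1], rule linearI)
    (simp_all add: matrix_vector_mult_def vec_eq_iff scaleR_sum_right sum.distrib distrib_left)

lemma l2_zero: "l2 (\<lambda>i. 0)"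
  by (simp add: l2_def)

lemma l2_add:
  assumes "l2 x" "l2 y" shows "l2 (\<lambda>i. x i + y i)"
proof -
  have "(\<lambda>i. 2 * (norm (x i))\<^sup>2 + 2 * (norm (y i))\<^sup>2) summable_on UNIV"
    using assms by (intro summable_on_add summable_on_cmult_right) (simp_all add: l2_def)
  moreover have "(norm (x i + y i))\<^sup>2 \<le> 2 * (norm (x i))\<^sup>2 + 2 * (norm (y i))\<^sup>2" for i
  proof -
    have "(norm (x i + y i))\<^sup>2 \<le> (norm (x i) + norm (y i))\<^sup>2"
      by (simp add: norm_triangle_ineq power_mono)
    also have "\<dots> \<le> 2 * (norm (x i))\<^sup>2 + 2 * (norm (y i))\<^sup>2"
      using sum_squares_bound[of "norm (x i)" "norm (y i)"] by (simp add: power2_sum)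
    finally show ?thesis .
  qed
  ultimately show ?thesis
    unfolding l2_def by (rule summable_on_comparison_test) auto
qed

lemma l2_scaleR:
  assumes "l2 x" shows "l2 (\<lambda>i. r *\<^sub>R x i)"
  using assms unfolding l2_def
  by (simp add: power_mult_distrib summable_on_cmult_right)

lemma l2_finite_support:
  assumes "finite F" "\<And>i. i \<notin> F \<Longrightarrow> x i = 0" shows "l2 x"
proof -
  have "(\<lambda>i. (norm (x i))\<^sup>2) summable_on F" using assms(1) by simp
  then show ?thesis unfolding l2_def
    by (rule summable_on_cong_neutral[THEN iffD1, rotated -1]) (auto simp: assms(2))
qed

lemma inner_l2_summable:
  fixes x y :: "'t \<Rightarrow> 'a::real_inner"
  assumes "l2 x" "l2 y" shows "(\<lambda>i. inner (x i) (y i)) summable_on UNIV"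
proof (rule abs_summable_summable, rule Infinite_Sum.abs_summable_on_comparison_test)
  show "(\<lambda>i. norm ((norm (x i))\<^sup>2 + (norm (y i))\<^sup>2)) summable_on UNIV"
    using assms by (simp add: l2_def summable_on_add)
  show "norm (inner (x i) (y i)) \<le> norm ((norm (x i))\<^sup>2 + (norm (y i))\<^sup>2)" for i
  proof -
    have "0 \<le> norm (x i) * norm (y i)" by simp
    then have "\<bar>inner (x i) (y i)\<bar> \<le> (norm (x i))\<^sup>2 + (norm (y i))\<^sup>2"
      using Cauchy_Schwarz_ineq2[of "x i" "y i"] sum_squares_bound[of "norm (x i)" "norm (y i)"]
      by linarith
    then show ?thesis by simp
  qed
qed

section \<open>The inner product space of square-summable sequences\<close>

typedef (overloaded) ('t, 'a) ell2 = "{x :: 't \<Rightarrow> 'a::real_inner. l2 x}"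
  using l2_zero by auto

setup_lifting type_definition_ell2

instantiation ell2 :: (type, real_inner) real_vector
begin
lift_definition zero_ell2 :: "('a, 'b) ell2" is "\<lambda>_. 0" by (rule l2_zero)
lift_definition plus_ell2 :: "('a, 'b) ell2 \<Rightarrow> ('a, 'b) ell2 \<Rightarrow> ('a, 'b) ell2"
  is "\<lambda>x y i. x i + y i" by (rule l2_add)
lift_definition scaleR_ell2 :: "real \<Rightarrow> ('a, 'b) ell2 \<Rightarrow> ('a, 'b) ell2"
  is "\<lambda>r x i. r *\<^sub>R x i" by (rule l2_scaleR)
lift_definition uminus_ell2 :: "('a, 'b) ell2 \<Rightarrow> ('a, 'b) ell2"
  is "\<lambda>x i. - x i" by (simp add: l2_def)
lift_definition minus_ell2 :: "('a, 'b) ell2 \<Rightarrow> ('a, 'b) ell2 \<Rightarrow> ('a, 'b) ell2"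
  is "\<lambda>x y i. x i - y i"
  subgoal for x y using l2_add[of x "\<lambda>i. - y i"] by (simp add: l2_def)
  done
instance
proof
  fix x y z :: "('a, 'b) ell2" and r q :: real
  show "x + y + z = x + (y + z)" by transfer (simp add: add.assoc)
  show "x + y = y + x" by transfer (simp add: add.commute)
  show "0 + x = x" by transfer simp
  show "- x + x = 0" by transfer simp
  show "x - y = x + - y" by transfer simp
  show "r *\<^sub>R (x + y) = r *\<^sub>R x + r *\<^sub>R y" by transfer (simp add: scaleR_add_right)
  show "(r + q) *\<^sub>R x = r *\<^sub>R x + q *\<^sub>R x" by transfer (simp add: scaleR_add_left)
  show "r *\<^sub>R q *\<^sub>R x = (r * q) *\<^sub>R x" by transfer simp
  show "1 *\<^sub>R x = x" by transfer simp
qed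
end

instantiation ell2 :: (type, real_inner) real_inner
begin
lift_definition inner_ell2 :: "('a, 'b) ell2 \<Rightarrow> ('a, 'b) ell2 \<Rightarrow> real"
  is "\<lambda>x y. \<Sum>\<^sub>\<infinity>i. inner (x i) (y i)" .
definition norm_ell2 :: "('a, 'b) ell2 \<Rightarrow> real" where "norm_ell2 x = sqrt (inner x x)"
definition sgn_ell2 :: "('a, 'b) ell2 \<Rightarrow> ('a, 'b) ell2" where "sgn_ell2 x = x /\<^sub>R norm x"
definition dist_ell2 :: "('a, 'b) ell2 \<Rightarrow> ('a, 'b) ell2 \<Rightarrow> real"
  where "dist_ell2 x y = norm (x - y)"
definition uniformity_ell2 :: "(('a, 'b) ell2 \<times> ('a, 'b) ell2) filter"
  where "uniformity_ell2 = (INF e\<in>{0<..}. principal {(x, y). dist x y < e})"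
definition open_ell2 :: "('a, 'b) ell2 set \<Rightarrow> bool"
  where "open_ell2 S \<longleftrightarrow> (\<forall>x\<in>S. eventually (\<lambda>(x', y). x' = x \<longrightarrow> y \<in> S) uniformity)"
instance
proof
  fix x y z :: "('a, 'b) ell2" and r :: real
  show "inner x y = inner y x"
    by transfer (simp add: inner_commute)
  show "inner (x + y) z = inner x z + inner y z"
    by transfer (simp add: inner_add_left infsum_add inner_l2_summable)
  show "inner (r *\<^sub>R x) y = r * inner x y"
    by transfer (simp add: infsum_cmult_right')
  show "0 \<le> inner x x"
    by transfer (simp add: infsum_nonneg)
  show "inner x x = 0 \<longleftrightarrow> x = 0"
  proof transfer
    fix x :: "'a \<Rightarrow> 'b" assume x: "l2 x"
    show "(\<Sum>\<^sub>\<infinity>i. inner (x i) (x i)) = 0 \<longleftrightarrow> x = (\<lambda>_. 0)"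
    proof
      assume 0: "(\<Sum>\<^sub>\<infinity>i. inner (x i) (x i)) = 0"
      have "inner (x i) (x i) = 0" for i
        by (rule nonneg_infsum_le_0D[OF _ inner_l2_summable[OF x x]]) (use 0 in auto)
      then show "x = (\<lambda>_. 0)" by auto
    qed simp
  qed
qed (rule norm_ell2_def sgn_ell2_def dist_ell2_def uniformity_ell2_def open_ell2_def)+
end

lemma norm_Rep_ell2: "norm x = l2norm (Rep_ell2 x)"
  by (simp add: norm_ell2_def l2norm_def inner_ell2.rep_eq power2_norm_eq_inner)

lemma l2_Rep_ell2 [simp]: "l2 (Rep_ell2 x)"
  using Rep_ell2 by blast

lemma Rep_Abs_ell2: "l2 x \<Longrightarrow> Rep_ell2 (Abs_ell2 x) = x"
  by (simp add: Abs_ell2_inverse)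

lemma ell2_eqI: "(\<And>i. Rep_ell2 x i = Rep_ell2 y i) \<Longrightarrow> x = y"
  by (metis Rep_ell2_inject ext)

lemma has_sum_inner_ell2:
  "((\<lambda>i. inner (Rep_ell2 x i) (Rep_ell2 y i)) has_sum inner x y) UNIV"
  by (simp add: inner_ell2.rep_eq inner_l2_summable)

lemma l2norm_nonneg: "0 \<le> l2norm x"
  by (simp add: l2norm_def infsum_nonneg)

lemma L2_set_le_l2norm:
  assumes "l2 x" "finite F" shows "L2_set (\<lambda>i. norm (x i)) F \<le> l2norm x"
  unfolding L2_set_def l2norm_def
  using assms by (auto intro!: real_sqrt_le_mono finite_sum_le_infsum simp: l2_def)

lemma l2_if_L2_set_le:
  assumes "\<And>F. finite F \<Longrightarrow> L2_set (\<lambda>i. norm (x i)) F \<le> C"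
  shows "l2 x" and "l2norm x \<le> C"
proof -
  have C: "0 \<le> C" using assms[of "{}"] by simp
  have le: "(\<Sum>i\<in>F. (norm (x i))\<^sup>2) \<le> C\<^sup>2" if "finite F" for F
    using power_mono[OF assms[OF that] L2_set_nonneg, of 2]
    by (simp add: L2_set_def sum_nonneg)
  show 1: "l2 x" unfolding l2_def
    by (rule nonneg_bdd_above_summable_on) (auto intro!: bdd_aboveI[of _ "C\<^sup>2"] le)
  have "(\<Sum>\<^sub>\<infinity>i. (norm (x i))\<^sup>2) \<le> C\<^sup>2"
    by (rule infsum_le_finite_sums) (use 1 le in \<open>auto simp: l2_def\<close>)
  then show "l2norm x \<le> C"
    unfolding l2norm_def using C real_le_lsqrt by blast
qed

lemma summable_on_componentwise:
  fixes f :: "'i \<Rightarrow> 'a::euclidean_space"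
  assumes "\<And>b. b \<in> Basis \<Longrightarrow> (\<lambda>i. inner (f i) b) summable_on A"
  shows "f summable_on A"
proof -
  have "((\<lambda>i. \<Sum>b\<in>B. inner (f i) b *\<^sub>R b) has_sum (\<Sum>b\<in>B. infsum (\<lambda>i. inner (f i) b) A *\<^sub>R b)) A"
    if "B \<subseteq> Basis" for B
    using finite_subset[OF that finite_Basis] that
    by (induction B rule: finite_induct)
      (auto intro!: has_sum_add has_sum_bounded_linear[OF bounded_linear_scaleR_left] has_sum_infsum assms)
  from this[of Basis] show ?thesis
    by (auto simp: euclidean_representation summable_on_def)
qed

lemma summable_on_if_abs_sums_le:
  fixes g :: "'i \<Rightarrow> real"
  assumes "\<And>F. finite F \<Longrightarrow> (\<Sum>i\<in>F. \<bar>g i\<bar>) \<le> C"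
  shows "g summable_on UNIV"
proof -
  have "(\<lambda>i. norm (g i)) summable_on UNIV"
    by (rule nonneg_bdd_above_summable_on) (auto intro!: bdd_aboveI[of _ C] assms)
  then show ?thesis by (rule abs_summable_summable)
qed

lemma linear_matrix_vector [simp]: "linear ((*v) (M :: ('k::{real_normed_field,euclidean_space})^'n::finite^'m::finite))"
  using bounded_linear.linear[OF bounded_linear_matrix_vector_right] .

lemma inner_mat_adj_left: "inner (mat_adj M *v x) y = inner (M *v y) x"
  by (metis inner_commute inner_mat_adj mat_adj_mat_adj)

section \<open>Bounded block matrices\<close>

text \<open>
  A bound on finite sections, which unlike \<open>bounded_by\<close> is visibly preserved by adjoints and
  by entrywise limits.
\<close>

definition form_bound ::
  "('t, 'k::{real_normed_field,euclidean_space}, 'm::finite, 'n::finite) block_op \<Rightarrow> real \<Rightarrow> bool" where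
  "form_bound A c \<longleftrightarrow> (\<forall>F G x y. finite F \<longrightarrow> finite G \<longrightarrow>
    (\<Sum>i\<in>F. \<Sum>j\<in>G. inner (A i j *v x j) (y i))
      \<le> c * (L2_set (\<lambda>j. norm (x j)) G * L2_set (\<lambda>i. norm (y i)) F))"

lemma form_boundD:
  "form_bound A c \<Longrightarrow> finite F \<Longrightarrow> finite G \<Longrightarrow>
    (\<Sum>i\<in>F. \<Sum>j\<in>G. inner (A i j *v x j) (y i))
      \<le> c * (L2_set (\<lambda>j. norm (x j)) G * L2_set (\<lambda>i. norm (y i)) F)"
  unfolding form_bound_def by blast

lemma form_bound_op_adj:
  fixes A :: "('t, 'k::{real_normed_field,euclidean_space}, 'm::finite, 'n::finite) block_op"
  assumes "form_bound A c" shows "form_bound (op_adj A) c"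
  unfolding form_bound_def
proof (intro allI impI)
  fix F G :: "'t set" and x :: "'t \<Rightarrow> 'k^'m" and y :: "'t \<Rightarrow> 'k^'n"
  assume "finite F" "finite G"
  have "(\<Sum>i\<in>F. \<Sum>j\<in>G. inner (op_adj A i j *v x j) (y i))
      = (\<Sum>j\<in>G. \<Sum>i\<in>F. inner (A j i *v y i) (x j))"
    by (subst sum.swap) (simp add: op_adj_apply inner_mat_adj_left)
  also have "\<dots> \<le> c * (L2_set (\<lambda>i. norm (y i)) F * L2_set (\<lambda>j. norm (x j)) G)"
    by (rule form_boundD) fact+
  finally show "(\<Sum>i\<in>F. \<Sum>j\<in>G. inner (op_adj A i j *v x j) (y i))
      \<le> c * (L2_set (\<lambda>j. norm (x j)) G * L2_set (\<lambda>i. norm (y i)) F)"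
    by (simp add: mult.commute)
qed

text \<open>The form is tested on the single row \<open>i\<close>, with the signs of the terms
  absorbed into \<open>x\<close>; this bounds the absolute sums of each real component.\<close>

lemma form_bound_summable:
  fixes A :: "('t, 'k::{real_normed_field,euclidean_space}, 'm::finite, 'n::finite) block_op"
  assumes A: "form_bound A c" and c: "0 \<le> c" and x: "l2 x"
  shows "(\<lambda>j. A i j *v x j) summable_on UNIV"
proof (rule summable_on_componentwise, rule summable_on_if_abs_sums_le)
  fix b :: "'k^'m" and F :: "'t set" assume F: "finite F"
  define s where "s j = sgn (inner (A i j *v x j) b)" for j
  have "(\<Sum>j\<in>F. \<bar>inner (A i j *v x j) b\<bar>) = (\<Sum>i\<in>{i}. \<Sum>j\<in>F. inner (A i j *v (s j *\<^sub>R x j)) b)"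
    by (simp add: linear_cmul[OF linear_matrix_vector] s_def abs_sgn mult.commute)
  also have "\<dots> \<le> c * (L2_set (\<lambda>j. norm (s j *\<^sub>R x j)) F * L2_set (\<lambda>i. norm b) {i})"
    by (rule form_boundD[OF A _ F]) simp
  also have "L2_set (\<lambda>j. norm (s j *\<^sub>R x j)) F \<le> L2_set (\<lambda>j. norm (x j)) F"
    by (rule L2_set_mono) (auto simp: s_def sgn_real_def)
  also have "L2_set (\<lambda>j. norm (x j)) F \<le> l2norm x"
    using x F by (rule L2_set_le_l2norm)
  finally show "(\<Sum>j\<in>F. \<bar>inner (A i j *v x j) b\<bar>) \<le> c * (l2norm x * L2_set (\<lambda>i. norm b) {i})"
    using c by (simp add: mult_left_mono mult_right_mono)
qed

text \<open>Testing the form with \<open>y\<close> equal to \<open>op_apply A x\<close> itself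
  bounds the square of the norm over \<open>F\<close> by \<open>c * l2norm x\<close> times that
  norm, and one factor cancels. The bound over finite \<open>G\<close> passes to the limit because
  \<open>F\<close> is finite and fixed.\<close>

lemma form_bound_L2_set_op_apply:
  assumes A: "form_bound A c" and c: "0 \<le> c" and x: "l2 x" and F: "finite F"
  shows "L2_set (\<lambda>i. norm (op_apply A x i)) F \<le> c * l2norm x"
proof -
  let ?y = "op_apply A x" and ?L = "L2_set (\<lambda>i. norm (op_apply A x i)) F"
  have "((\<lambda>G. \<Sum>j\<in>G. A i j *v x j) \<longlongrightarrow> ?y i) (finite_subsets_at_top UNIV)" for i
    using has_sum_infsum[OF form_bound_summable[OF A c x, of i]]
    by (simp add: op_apply_def has_sum_def)
  then have "((\<lambda>G. \<Sum>i\<in>F. \<Sum>j\<in>G. inner (A i j *v x j) (?y i)) \<longlongrightarrow> (\<Sum>i\<in>F. inner (?y i) (?y i)))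
      (finite_subsets_at_top UNIV)"
    by (auto intro!: tendsto_sum tendsto_inner simp: simp flip: inner_sum_left)
  moreover have "(\<Sum>i\<in>F. \<Sum>j\<in>G. inner (A i j *v x j) (?y i)) \<le> c * (l2norm x * ?L)" if G: "finite G" for G
  proof -
    have "(\<Sum>i\<in>F. \<Sum>j\<in>G. inner (A i j *v x j) (?y i)) \<le> c * (L2_set (\<lambda>j. norm (x j)) G * ?L)"
      by (rule form_boundD[OF A F G])
    also have "\<dots> \<le> c * (l2norm x * ?L)"
      by (intro mult_left_mono mult_right_mono L2_set_le_l2norm x G c L2_set_nonneg)
    finally show ?thesis .
  qed
  ultimately have "(\<Sum>i\<in>F. inner (?y i) (?y i)) \<le> c * (l2norm x * ?L)"
    by (intro tendsto_upperbound) (auto intro!: eventually_finite_subsets_at_top_weakI)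
  then have "?L * ?L \<le> (c * l2norm x) * ?L"
    by (simp add: L2_set_def power2_norm_eq_inner sum_nonneg mult.assoc)
  then show ?thesis
    by (cases "?L = 0") (use c l2norm_nonneg[of x] L2_set_nonneg[of "\<lambda>i. norm (op_apply A x i)" F] in
        \<open>auto simp: mult_le_cancel_right\<close>)
qed

lemma bounded_by_imp_form_bound:
  fixes A :: "('t, 'k::{real_normed_field,euclidean_space}, 'm::finite, 'n::finite) block_op"
  assumes A: "bounded_by A c" shows "form_bound A c"
  unfolding form_bound_def
proof (intro allI impI)
  fix F G :: "'t set" and x :: "'t \<Rightarrow> 'k^'n" and y :: "'t \<Rightarrow> 'k^'m"
  assume F: "finite F" and G: "finite G"
  \<comment> \<open>Extension by zero outside \<open>G\<close> turns the finite section of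
    \<open>A\<close> into \<open>A\<close> applied to a genuine \<open>l2\<close> sequence.\<close>
  define x' where "x' j = (if j \<in> G then x j else 0)" for j
  have x': "l2 x'" by (rule l2_finite_support[OF G]) (simp add: x'_def)
  have norm_x': "l2norm x' = L2_set (\<lambda>j. norm (x j)) G"
  proof -
    have "(\<Sum>\<^sub>\<infinity>i. (norm (x' i))\<^sup>2) = (\<Sum>\<^sub>\<infinity>i\<in>G. (norm (x i))\<^sup>2)"
      by (rule infsum_cong_neutral) (auto simp: x'_def)
    then show ?thesis using G by (simp add: l2norm_def L2_set_def)
  qed
  have apply_x': "op_apply A x' i = (\<Sum>j\<in>G. A i j *v x j)" for i
  proof -
    have "op_apply A x' i = (\<Sum>\<^sub>\<infinity>j\<in>G. A i j *v x j)"
      unfolding op_apply_def by (rule infsum_cong_neutral) (auto simp: x'_def)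
    then show ?thesis using G by simp
  qed
  have "(\<Sum>i\<in>F. \<Sum>j\<in>G. inner (A i j *v x j) (y i)) = (\<Sum>i\<in>F. inner (op_apply A x' i) (y i))"
    by (simp add: apply_x' inner_sum_left)
  also have "\<dots> \<le> (\<Sum>i\<in>F. \<bar>norm (op_apply A x' i)\<bar> * \<bar>norm (y i)\<bar>)"
    by (rule sum_mono) (simp add: norm_cauchy_schwarz)
  also have "\<dots> \<le> L2_set (\<lambda>i. norm (op_apply A x' i)) F * L2_set (\<lambda>i. norm (y i)) F"
    by (rule L2_set_mult_ineq)
  also have "\<dots> \<le> (c * l2norm x') * L2_set (\<lambda>i. norm (y i)) F"
  proof (rule mult_right_mono[OF _ L2_set_nonneg])
    have "L2_set (\<lambda>i. norm (op_apply A x' i)) F \<le> l2norm (op_apply A x')"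
      using A x' F by (simp add: bounded_by_def L2_set_le_l2norm)
    also have "\<dots> \<le> c * l2norm x'" using A x' by (simp add: bounded_by_def)
    finally show "L2_set (\<lambda>i. norm (op_apply A x' i)) F \<le> c * l2norm x'" .
  qed
  finally show "(\<Sum>i\<in>F. \<Sum>j\<in>G. inner (A i j *v x j) (y i))
      \<le> c * (L2_set (\<lambda>j. norm (x j)) G * L2_set (\<lambda>i. norm (y i)) F)"
    by (simp add: norm_x' mult.assoc)
qed

lemma bounded_by_iff_form_bound:
  assumes c: "0 \<le> c" shows "bounded_by A c \<longleftrightarrow> form_bound A c"
proof
  assume A: "form_bound A c"
  show "bounded_by A c"
    unfolding bounded_by_def
    using form_bound_summable[OF A c] l2_if_L2_set_le[OF form_bound_L2_set_op_apply[OF A c]] by blast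
qed (rule bounded_by_imp_form_bound)

lemma bounded_by_mono:
  assumes "bounded_by A c" "c \<le> d" shows "bounded_by A d"
  using assms unfolding bounded_by_def
  by (meson l2norm_nonneg mult_right_mono order_trans)

lemma bounded_opE:
  assumes "bounded_op A" obtains c where "0 \<le> c" "bounded_by A c"
  using assms bounded_by_mono[OF _ max.cobounded1] max.cobounded2 unfolding bounded_op_def by metis

lemma bounded_op_adj: "bounded_op A \<Longrightarrow> bounded_op (op_adj A)"
  by (meson bounded_opE bounded_by_iff_form_bound form_bound_op_adj bounded_op_def)

section \<open>Bounded block matrices as linear maps\<close>

text \<open>Meaningful for bounded \<open>A\<close> only: otherwise \<open>Abs_ell2\<close> may be
  applied outside its domain. Hence the boundedness assumptions below.\<close>

definition opf ::
  "('t, 'k::{real_normed_field,euclidean_space}, 'm::finite, 'n::finite) block_op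
    \<Rightarrow> ('t, 'k^'n) ell2 \<Rightarrow> ('t, 'k^'m) ell2" where
  "opf A x = Abs_ell2 (op_apply A (Rep_ell2 x))"

lift_definition esingle :: "'t \<Rightarrow> 'a::real_inner \<Rightarrow> ('t, 'a) ell2" is "\<lambda>i v j. if j = i then v else 0"
  by (rule l2_finite_support[of "{i}" for i]) auto

lemma Rep_ell2_zero [simp]: "Rep_ell2 0 i = 0"
  by (simp add: zero_ell2.rep_eq)

lemma Rep_ell2_add [simp]: "Rep_ell2 (x + y) i = Rep_ell2 x i + Rep_ell2 y i"
  by (simp add: plus_ell2.rep_eq)

lemma Rep_ell2_diff [simp]: "Rep_ell2 (x - y) i = Rep_ell2 x i - Rep_ell2 y i"
  by (simp add: minus_ell2.rep_eq)

lemma Rep_ell2_uminus [simp]: "Rep_ell2 (- x) i = - Rep_ell2 x i"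
  by (simp add: uminus_ell2.rep_eq)

lemma Rep_ell2_scaleR [simp]: "Rep_ell2 (r *\<^sub>R x) i = r *\<^sub>R Rep_ell2 x i"
  by (simp add: scaleR_ell2.rep_eq)

lemma Rep_ell2_sum: "Rep_ell2 (sum f F) i = (\<Sum>k\<in>F. Rep_ell2 (f k) i)"
  by (induction F rule: infinite_finite_induct) auto

lemma Rep_esingle: "Rep_ell2 (esingle i v) j = (if j = i then v else 0)"
  by (simp add: esingle.rep_eq)

lemma has_sum_single:
  "((\<lambda>j. if j = i then f j else 0) has_sum f i) UNIV"
  using has_sum_finite_neutralI[of "{i}" UNIV "\<lambda>j. if j = i then f j else 0" "f i"] by simp

lemma inner_esingle: "inner x (esingle i v) = inner (Rep_ell2 x i) v"
proof -
  have "((\<lambda>j. if j = i then inner (Rep_ell2 x j) v else 0) has_sum inner x (esingle i v)) UNIV"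
    using has_sum_inner_ell2[of x "esingle i v"] by (simp add: Rep_esingle if_distrib cong: if_cong)
  from has_sum_unique[OF this has_sum_single] show ?thesis .
qed

lemma bounded_opD:
  assumes "bounded_op A" "l2 x"
  shows "(\<lambda>j. A i j *v x j) summable_on UNIV" "l2 (op_apply A x)"
  using assms unfolding bounded_op_def bounded_by_def by blast+

lemma Rep_opf: "bounded_op A \<Longrightarrow> Rep_ell2 (opf A x) = op_apply A (Rep_ell2 x)"
  by (simp add: opf_def Rep_Abs_ell2 bounded_opD)

lemma norm_opf_le:
  assumes "bounded_by A c" shows "norm (opf A x) \<le> c * norm x"
proof -
  have "bounded_op A" using assms bounded_op_def by blast
  then show ?thesis
    using assms by (simp add: norm_Rep_ell2 Rep_opf bounded_by_def)
qed

lemma has_sum_opf: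
  "bounded_op A \<Longrightarrow> ((\<lambda>j. A i j *v Rep_ell2 x j) has_sum Rep_ell2 (opf A x) i) UNIV"
  by (simp add: Rep_opf op_apply_def bounded_opD)

lemma linear_opf:
  fixes A :: "('t, 'k::{real_normed_field,euclidean_space}, 'm::finite, 'n::finite) block_op"
  assumes A: "bounded_op A" shows "linear (opf A)"
proof (rule linearI)
  fix x y :: "('t, 'k^'n) ell2" and r :: real
  show "opf A (x + y) = opf A x + opf A y"
  proof (rule ell2_eqI)
    fix i
    have "((\<lambda>j. A i j *v Rep_ell2 (x + y) j) has_sum (Rep_ell2 (opf A x + opf A y) i)) UNIV"
      using has_sum_add[OF has_sum_opf[OF A, of i x] has_sum_opf[OF A, of i y]]
      by (simp add: linear_add[OF linear_matrix_vector])
    then show "Rep_ell2 (opf A (x + y)) i = Rep_ell2 (opf A x + opf A y) i"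
      using has_sum_opf[OF A] has_sum_unique by blast
  qed
  show "opf A (r *\<^sub>R x) = r *\<^sub>R opf A x"
  proof (rule ell2_eqI)
    fix i
    have "((\<lambda>j. A i j *v Rep_ell2 (r *\<^sub>R x) j) has_sum (Rep_ell2 (r *\<^sub>R opf A x) i)) UNIV"
      using has_sum_bounded_linear[OF bounded_linear_scaleR_right has_sum_opf[OF A, of i x], of r]
      by (simp add: linear_cmul[OF linear_matrix_vector])
    then show "Rep_ell2 (opf A (r *\<^sub>R x)) i = Rep_ell2 (r *\<^sub>R opf A x) i"
      using has_sum_opf[OF A] has_sum_unique by blast
  qed
qed

lemma bounded_linear_opf:
  assumes "bounded_op A" shows "bounded_linear (opf A)"
proof -
  obtain c where "bounded_by A c" using bounded_opE[OF assms] .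
  then show ?thesis
    by (intro bounded_linear_intro[where K = c])
      (simp_all add: linear_add linear_cmul linear_opf assms norm_opf_le mult.commute)
qed

lemma bounded_byI:
  fixes A :: "('t, 'k::{real_normed_field,euclidean_space}, 'm::finite, 'n::finite) block_op"
  assumes A: "bounded_op A" and "\<And>x. norm (opf A x) \<le> c * norm x"
  shows "bounded_by A c"
  unfolding bounded_by_def
proof (intro allI impI)
  fix x :: "'t \<Rightarrow> 'k^'n" assume x: "l2 x"
  have "l2norm (op_apply A x) \<le> c * l2norm x"
    using assms(2)[of "Abs_ell2 x"] x by (simp add: norm_Rep_ell2 Rep_opf[OF A] Rep_Abs_ell2)
  then show "(\<forall>i. (\<lambda>j. A i j *v x j) summable_on UNIV) \<and> l2 (op_apply A x) \<and>
      l2norm (op_apply A x) \<le> c * l2norm x"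
    using bounded_opD[OF A x] by blast
qed

lemma opf_esingle:
  assumes A: "bounded_op A" shows "Rep_ell2 (opf A (esingle j v)) i = A i j *v v"
proof -
  have "((\<lambda>l. if l = j then A i l *v v else 0) has_sum Rep_ell2 (opf A (esingle j v)) i) UNIV"
    using has_sum_opf[OF A, of i "esingle j v"] 
    by (simp add: Rep_esingle if_distrib linear_0[OF linear_matrix_vector] cong: if_cong)
  from has_sum_unique[OF this has_sum_single] show ?thesis .
qed

text \<open>The entry \<open>A i j\<close> is read off from the image of \<open>esingle j v\<close>,
  so identities between bounded block matrices reduce to identities between linear maps.\<close>

lemma block_op_eqI:
  assumes "bounded_op A" "bounded_op B" "\<And>x. opf A x = opf B x" shows "A = B"
proof (intro ext matrix_vector_ext)
  fix i j v
  show "A i j *v v = B i j *v v"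
    using assms(3)[of "esingle j v"] opf_esingle[OF assms(1)] opf_esingle[OF assms(2)] by metis
qed

text \<open>The squared distance to a finite truncation is \<open>inner y y\<close> minus a partial
  sum of the series for \<open>inner y y\<close>. This gives the density of finitely supported
  sequences, used below to extend identities by continuity.\<close>

lemma tendsto_esingle:
  "((\<lambda>F. \<Sum>i\<in>F. esingle i (Rep_ell2 y i)) \<longlongrightarrow> y) (finite_subsets_at_top UNIV)"
proof -
  let ?S = "\<lambda>F. \<Sum>i\<in>F. esingle i (Rep_ell2 y i)"
  have Rep_S: "Rep_ell2 (?S F) j = (if j \<in> F then Rep_ell2 y j else 0)" if "finite F" for F j
    using that by (induction F rule: finite_induct) (auto simp: Rep_esingle)
  have "(norm (?S F - y))\<^sup>2 = inner y y - (\<Sum>i\<in>F. inner (Rep_ell2 y i) (Rep_ell2 y i))" if F: "finite F" for F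
  proof -
    have 1: "inner x (?S F) = (\<Sum>i\<in>F. inner (Rep_ell2 x i) (Rep_ell2 y i))" for x
      by (simp add: inner_sum_right inner_esingle)
    have 2: "inner (?S F) (?S F) = (\<Sum>i\<in>F. inner (Rep_ell2 y i) (Rep_ell2 y i))"
      unfolding 1 by (simp add: Rep_S F)
    show ?thesis
      by (simp add: power2_norm_eq_inner inner_diff_left inner_diff_right inner_commute[of "?S F" y] 2)
        (simp add: 1)
  qed
  moreover have "((\<lambda>F. inner y y - (\<Sum>i\<in>F. inner (Rep_ell2 y i) (Rep_ell2 y i))) \<longlongrightarrow> inner y y - inner y y)
      (finite_subsets_at_top UNIV)"
    using has_sum_inner_ell2[of y y] by (intro tendsto_intros) (simp add: has_sum_def)
  ultimately have "((\<lambda>F. (norm (?S F - y))\<^sup>2) \<longlongrightarrow> 0) (finite_subsets_at_top UNIV)"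
    by (subst tendsto_cong[where g = "\<lambda>F. inner y y - (\<Sum>i\<in>F. inner (Rep_ell2 y i) (Rep_ell2 y i))"])
      (auto intro!: eventually_finite_subsets_at_top_weakI)
  then have "((\<lambda>F. sqrt ((norm (?S F - y))\<^sup>2)) \<longlongrightarrow> sqrt 0) (finite_subsets_at_top UNIV)"
    by (rule tendsto_real_sqrt)
  then show ?thesis
    by (simp add: tendsto_norm_zero_iff LIM_zero_iff)
qed

lemma bounded_linear_eqI_ell2:
  assumes "bounded_linear f" "bounded_linear g" "\<And>i v. f (esingle i v) = g (esingle i v)"
  shows "f x = g x"
proof -
  have lim: "((\<lambda>F. h (\<Sum>i\<in>F. esingle i (Rep_ell2 x i))) \<longlongrightarrow> h x) (finite_subsets_at_top UNIV)"
    if "bounded_linear h" for h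
    using bounded_linear.tendsto[OF that tendsto_esingle] .
  have "f (\<Sum>i\<in>F. esingle i (Rep_ell2 x i)) = g (\<Sum>i\<in>F. esingle i (Rep_ell2 x i))" for F
    using assms by (simp add: linear_sum[OF bounded_linear.linear])
  then show ?thesis
    using tendsto_unique[OF finite_subsets_at_top_neq_bot lim[OF assms(1)]] lim[OF assms(2)] by simp
qed

text \<open>The entrywise adjoint is the Hilbert space adjoint: for \<open>y = esingle i v\<close>
  both sides are the same sum over row \<open>i\<close>, and density of finitely supported sequences
  does the rest.\<close>

lemma inner_opf:
  assumes A: "bounded_op A" shows "inner (opf A x) y = inner x (opf (op_adj A) y)"
proof -
  note A' = bounded_op_adj[OF A]
  have "inner (opf A x) (esingle i v) = inner x (opf (op_adj A) (esingle i v))" for i v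
  proof -
    have "((\<lambda>j. inner (A i j *v Rep_ell2 x j) v) has_sum inner (opf A x) (esingle i v)) UNIV"
      unfolding inner_esingle
      by (rule has_sum_bounded_linear[OF bounded_linear_inner_left has_sum_opf[OF A]])
    then have "((\<lambda>j. inner (Rep_ell2 x j) (Rep_ell2 (opf (op_adj A) (esingle i v)) j))
        has_sum inner (opf A x) (esingle i v)) UNIV"
      by (simp add: opf_esingle[OF A'] op_adj_apply inner_mat_adj)
    then show ?thesis using has_sum_inner_ell2 has_sum_unique by blast
  qed
  then show ?thesis
    by (rule bounded_linear_eqI_ell2[OF bounded_linear_inner_right
          bounded_linear_compose[OF bounded_linear_inner_right bounded_linear_opf[OF A']]])
qed

text \<open>Boundedness of a block matrix is obtained from a bounded linear map with the same
  entries: finite sections of \<open>M\<close> are values of the form of \<open>T\<close> at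
  finitely supported vectors. Sums, multiples and products are all handled in this way.\<close>

lemma opf_eqI:
  fixes T :: "('t, 'k::{real_normed_field,euclidean_space}^'n::finite) ell2 \<Rightarrow> ('t, 'k^'m::finite) ell2"
  assumes T: "bounded_linear T" and M: "\<And>i j v. M i j *v v = Rep_ell2 (T (esingle j v)) i"
  shows "bounded_op M" and "opf M x = T x"
proof -
  obtain c where c: "0 \<le> c" "\<And>x. norm (T x) \<le> norm x * c"
    using bounded_linear.nonneg_bounded[OF T] by blast
  have L2: "norm (\<Sum>i\<in>F. esingle i (x i)) = L2_set (\<lambda>i. norm (x i)) F" if "finite F"
    for F and x :: "'t \<Rightarrow> 'k^'l::finite"
  proof -
    have "Rep_ell2 (\<Sum>i\<in>F. esingle i (x i)) j = (if j \<in> F then x j else 0)" for j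
      using that by (induction F rule: finite_induct) (auto simp: Rep_esingle)
    then have "inner (\<Sum>i\<in>F. esingle i (x i)) (\<Sum>i\<in>F. esingle i (x i)) = (\<Sum>i\<in>F. inner (x i) (x i))"
      unfolding inner_sum_right inner_esingle by simp
    then show ?thesis by (simp add: norm_eq_sqrt_inner L2_set_def power2_norm_eq_inner)
  qed
  have "form_bound M c"
    unfolding form_bound_def
  proof (intro allI impI)
    fix F G :: "'t set" and x :: "'t \<Rightarrow> 'k^'n" and y :: "'t \<Rightarrow> 'k^'m"
    assume F: "finite F" and G: "finite G"
    have "(\<Sum>i\<in>F. \<Sum>j\<in>G. inner (M i j *v x j) (y i))
        = inner (T (\<Sum>j\<in>G. esingle j (x j))) (\<Sum>i\<in>F. esingle i (y i))"
      by (simp add: linear_sum[OF bounded_linear.linear[OF T]] inner_sum_right inner_sum_left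
          inner_esingle M Rep_ell2_sum)
    also have "\<dots> \<le> norm (T (\<Sum>j\<in>G. esingle j (x j))) * norm (\<Sum>i\<in>F. esingle i (y i))"
      by (rule norm_cauchy_schwarz)
    also have "\<dots> \<le> (norm (\<Sum>j\<in>G. esingle j (x j)) * c) * norm (\<Sum>i\<in>F. esingle i (y i))"
      by (intro mult_right_mono c) simp
    finally show "(\<Sum>i\<in>F. \<Sum>j\<in>G. inner (M i j *v x j) (y i))
        \<le> c * (L2_set (\<lambda>j. norm (x j)) G * L2_set (\<lambda>i. norm (y i)) F)"
      by (simp add: L2 F G mult_ac)
  qed
  then show M': "bounded_op M"
    using bounded_by_iff_form_bound[OF c(1)] bounded_op_def by blast
  show "opf M x = T x"
    by (rule bounded_linear_eqI_ell2[OF bounded_linear_opf[OF M'] T])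
      (simp add: ell2_eqI opf_esingle[OF M'] M)
qed

lemma
  assumes A: "bounded_op A" and B: "bounded_op B"
  shows bounded_op_add: "bounded_op (A + B)" and opf_add: "opf (A + B) x = opf A x + opf B x"
    and bounded_op_diff: "bounded_op (A - B)" and opf_diff: "opf (A - B) x = opf A x - opf B x"
proof -
  have 1: "bounded_linear (\<lambda>x. opf A x + opf B x)" "bounded_linear (\<lambda>x. opf A x - opf B x)"
    using bounded_linear_add[OF bounded_linear_opf[OF A] bounded_linear_opf[OF B]]
      bounded_linear_sub[OF bounded_linear_opf[OF A] bounded_linear_opf[OF B]] .
  have 2: "(A + B) i j *v v = Rep_ell2 (opf A (esingle j v) + opf B (esingle j v)) i"
    "(A - B) i j *v v = Rep_ell2 (opf A (esingle j v) - opf B (esingle j v)) i" for i j v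
    by (simp_all add: opf_esingle A B matrix_vector_mult_add_rdistrib matrix_vector_mult_diff_rdistrib)
  show "bounded_op (A + B)" "opf (A + B) x = opf A x + opf B x"
    by (rule opf_eqI[OF 1(1) 2(1)])+
  show "bounded_op (A - B)" "opf (A - B) x = opf A x - opf B x"
    by (rule opf_eqI[OF 1(2) 2(2)])+
qed

lemma
  assumes A: "bounded_op A"
  shows bounded_op_scale: "bounded_op (op_scale r A)" and opf_scale: "opf (op_scale r A) x = r *\<^sub>R opf A x"
proof -
  have 1: "bounded_linear (\<lambda>x. r *\<^sub>R opf A x)"
    by (rule bounded_linear_compose[OF bounded_linear_scaleR_right bounded_linear_opf[OF A]])
  have 2: "op_scale r A i j *v v = Rep_ell2 (r *\<^sub>R opf A (esingle j v)) i" for i j v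
    by (simp add: opf_esingle A op_scale_def linear_cmul[OF bounded_linear.linear[OF bounded_linear_matrix_vector_left]])
  show "bounded_op (op_scale r A)" "opf (op_scale r A) x = r *\<^sub>R opf A x"
    by (rule opf_eqI[OF 1 2])+
qed

lemma
  fixes x :: "('t, 'k::{real_normed_field,euclidean_space}^'n::finite) ell2"
  shows bounded_op_id: "bounded_op (op_id :: ('t, 'k, 'n, 'n) block_op)"
    and opf_id: "opf op_id x = x"
proof -
  have 1: "op_id i j *v v = Rep_ell2 (esingle j v) i" for i j :: 't and v :: "'k^'n"
    by (simp add: op_id_def Rep_esingle)
  show "bounded_op (op_id :: ('t, 'k, 'n, 'n) block_op)" "opf op_id x = x"
    by (rule opf_eqI[OF bounded_linear_ident 1])+
qed

text \<open>Coordinate vectors suffice: the entry in row \<open>p\<close> and column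
  \<open>q\<close> of a partial sum is component \<open>p\<close> of its value at
  \<open>axis q 1\<close>.\<close>

lemma has_sum_matrixI:
  fixes M :: "'i \<Rightarrow> ('k::{real_normed_field,euclidean_space})^'n::finite^'m::finite"
  assumes "\<And>v. ((\<lambda>k. M k *v v) has_sum s v) I"
  shows "M summable_on I" and "infsum M I *v v = s v"
proof -
  have "((\<lambda>F. sum M F $ p $ q) \<longlongrightarrow> s (axis q 1) $ p) (finite_subsets_at_top I)" for p q
  proof -
    have "((\<lambda>F. (\<Sum>k\<in>F. M k *v axis q 1) $ p) \<longlongrightarrow> s (axis q 1) $ p) (finite_subsets_at_top I)"
      using assms[of "axis q 1"] unfolding has_sum_def by (rule tendsto_vec_nth)
    then show ?thesis by (simp add: matrix_vector_mult_def axis_def if_distrib cong: if_cong)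
  qed
  then have "(M has_sum (\<chi> p q. s (axis q 1) $ p)) I"
    unfolding has_sum_def by (intro vec_tendstoI) simp
  then show 1: "M summable_on I" by (auto simp: summable_on_def)
  show "infsum M I *v v = s v"
    using has_sum_bounded_linear[OF bounded_linear_matrix_vector_left[of v] has_sum_infsum[OF 1]]
      assms[of v] has_sum_unique by blast
qed

text \<open>The series for an entry of \<open>A \<odot> B\<close> converges because, applied to
  \<open>v\<close>, it is a row of \<open>A\<close> acting on the \<open>l2\<close> sequence
  \<open>opf B (esingle j v)\<close>.\<close>

lemma
  assumes A: "bounded_op A" and B: "bounded_op B"
  shows bounded_op_mult: "bounded_op (A \<odot> B)" and opf_mult: "opf (A \<odot> B) x = opf A (opf B x)"
proof -
  have 1: "bounded_linear (\<lambda>x. opf A (opf B x))"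
    by (rule bounded_linear_compose[OF bounded_linear_opf[OF A] bounded_linear_opf[OF B]])
  have 2: "(A \<odot> B) i j *v v = Rep_ell2 (opf A (opf B (esingle j v))) i" for i j v
    unfolding op_mult_def
  proof (rule has_sum_matrixI(2))
    show "((\<lambda>k. (A i k ** B k j) *v v) has_sum Rep_ell2 (opf A (opf B (esingle j v))) i) UNIV" for v
      using has_sum_opf[OF A, of i "opf B (esingle j v)"]
      by (simp add: opf_esingle[OF B] matrix_vector_mul_assoc)
  qed
  show "bounded_op (A \<odot> B)" "opf (A \<odot> B) x = opf A (opf B x)"
    by (rule opf_eqI[OF 1 2])+
qed

section \<open>Algebra of bounded block matrices, operator norm and causality\<close>

lemmas bounded_op_intros =
  bounded_op_mult bounded_op_add bounded_op_diff bounded_op_scale bounded_op_id bounded_op_adj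

lemma op_mult_assoc:
  assumes "bounded_op A" "bounded_op B" "bounded_op C"
  shows "(A \<odot> B) \<odot> C = A \<odot> (B \<odot> C)"
  by (rule block_op_eqI) (simp_all add: assms bounded_op_intros opf_mult)

lemma op_mult_id_left: "bounded_op A \<Longrightarrow> op_id \<odot> A = A"
  by (rule block_op_eqI) (simp_all add: bounded_op_intros opf_mult opf_id)

lemma op_mult_id_right: "bounded_op A \<Longrightarrow> A \<odot> op_id = A"
  by (rule block_op_eqI) (simp_all add: bounded_op_intros opf_mult opf_id)

lemma bounded_by_iff_norm_opf:
  "bounded_by A c \<longleftrightarrow> bounded_op A \<and> (\<forall>x. norm (opf A x) \<le> c * norm x)"
  using bounded_byI[of A c] norm_opf_le[of A c] by (auto simp: bounded_op_def)

lemma opnorm_lessD: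
  assumes "opnorm A < ennreal c" obtains d where "0 \<le> d" "d < c" "bounded_by A d"
  using assms unfolding opnorm_def Inf_less_iff by (auto simp: ennreal_less_iff)

text \<open>The infimum in \<open>opnorm\<close> is attained: \<open>A\<close> is bounded by
  \<open>c + e\<close> for every \<open>e > 0\<close>, and letting \<open>e\<close> tend to
  \<open>0\<close> at each fixed \<open>x\<close> gives the bound \<open>c\<close>.\<close>

lemma opnorm_le_iff:
  assumes c: "0 \<le> c" shows "opnorm A \<le> ennreal c \<longleftrightarrow> bounded_by A c"
proof
  assume "bounded_by A c"
  then show "opnorm A \<le> ennreal c"
    unfolding opnorm_def using c by (intro Inf_lower) blast
next
  assume le: "opnorm A \<le> ennreal c"
  have A: "bounded_by A (c + e)" if "0 < e" for e
  proof -
    have "ennreal c < ennreal (c + e)" using c that by (simp add: ennreal_less_iff)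
    with le have "opnorm A < ennreal (c + e)" by (rule order.strict_trans1)
    then obtain d where "d < c + e" "bounded_by A d" by (rule opnorm_lessD)
    then show ?thesis using bounded_by_mono less_imp_le by blast
  qed
  have "norm (opf A x) \<le> c * norm x" for x
  proof (cases "norm x = 0")
    case True
    then show ?thesis using norm_opf_le[OF A[of 1], of x] by simp
  next
    case False
    show ?thesis
    proof (rule field_le_epsilon)
      fix e :: real assume "0 < e"
      then have "norm (opf A x) \<le> (c + e / norm x) * norm x"
        using False by (intro norm_opf_le A) simp
      then show "norm (opf A x) \<le> c * norm x + e" using False by (simp add: distrib_right)
    qed
  qed
  moreover have "bounded_op A" using A[of 1] bounded_op_def by auto
  ultimately show "bounded_by A c" by (rule bounded_byI[rotated])
qed

text \<open>Replaces the definite description by a concrete inverse. Uniqueness is the usual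
  \<open>B' = B' \<odot> (A \<odot> B) = B\<close>, where associativity rests on the boundedness
  that \<open>is_op_inverse\<close> includes.\<close>

lemma op_inv_eqI:
  assumes A: "bounded_op A" and B: "is_op_inverse A B" shows "op_inv A = B"
  unfolding op_inv_def
proof (rule the_equality[of "is_op_inverse A", OF B])
  fix B' assume B': "is_op_inverse A B'"
  have "B' = B' \<odot> (A \<odot> B)"
    using B B' by (simp add: is_op_inverse_def op_mult_id_right)
  also have "\<dots> = (B' \<odot> A) \<odot> B"
    using A B B' op_mult_assoc[of B' A B] by (simp add: is_op_inverse_def)
  also have "\<dots> = B"
    using B B' by (simp add: is_op_inverse_def op_mult_id_left)
  finally show "B' = B" .
qed

lemma canonical_factorE:
  assumes "canonical_factor D"
  obtains "bounded_op D" "causal D" "bounded_op (op_inv D)" "causal (op_inv D)"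
    "D \<odot> op_inv D = op_id" "op_inv D \<odot> D = op_id"
proof -
  obtain E where D: "bounded_op D" "causal D" and E: "causal E" "is_op_inverse D E"
    using assms unfolding canonical_factor_def by blast
  have "op_inv D = E" by (rule op_inv_eqI) fact+
  then show thesis using that D E by (simp add: is_op_inverse_def)
qed

text \<open>For \<open>i < j\<close> every index \<open>k\<close> lies above \<open>i\<close> or
  below \<open>j\<close>, so the series vanishes term by term, and unbounded factors are
  allowed.\<close>

lemma causal_op_mult:
  assumes "causal A" "causal B" shows "causal (A \<odot> B)"
  unfolding causal_def
proof (intro allI impI)
  fix i j :: 'a assume "i < j"
  have "A i k ** B k j = 0" for k
  proof (cases "i < k")
    case True
    then show ?thesis using assms(1) by (simp add: causal_def)
  next
    case False
    then have "k < j" using \<open>i < j\<close> by simp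
    then show ?thesis using assms(2) by (simp add: causal_def)
  qed
  then show "(A \<odot> B) i j = 0" by (simp add: op_mult_def)
qed

lemma causal_add: "causal A \<Longrightarrow> causal B \<Longrightarrow> causal (A + B)"
  by (simp add: causal_def)

lemma causal_diff: "causal A \<Longrightarrow> causal B \<Longrightarrow> causal (A - B)"
  by (simp add: causal_def)

lemma causal_causal_part: "causal (causal_part A)"
  by (auto simp: causal_def causal_part_def)

lemma causal_part_add_anticausal_part: "causal_part A + anticausal_part A = A"
  by (auto simp: causal_part_def anticausal_part_def fun_eq_iff)

section \<open>Constant diagonal operators and stacked blocks\<close>

definition op_diag ::
  "('k::{real_normed_field,euclidean_space})^'n::finite^'m::finite \<Rightarrow> ('t, 'k, 'm, 'n) block_op" where
  "op_diag d = (\<lambda>i j. if i = j then d else 0)"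

lemma bounded_op_op_diag:
  fixes d :: "('k::{real_normed_field,euclidean_space})^'n::finite^'m::finite"
  shows "bounded_op (op_diag d :: ('t, 'k, 'm, 'n) block_op)"
proof -
  obtain K where K: "0 \<le> K" "\<And>v. norm (d *v v) \<le> norm v * K"
    using bounded_linear.nonneg_bounded[OF bounded_linear_matrix_vector_right] by blast
  have has_sum: "((\<lambda>j. op_diag d i j *v x j) has_sum d *v x i) UNIV" for i :: 't and x
    using has_sum_single[of i "\<lambda>j. d *v x j"]
    by (rule has_sum_cong[THEN iffD1, rotated]) (auto simp: op_diag_def)
  have "L2_set (\<lambda>i. norm (d *v x i)) F \<le> K * l2norm x" if x: "l2 x" and F: "finite F"
    for x :: "'t \<Rightarrow> 'k^'n" and F
  proof -
    have "L2_set (\<lambda>i. norm (d *v x i)) F \<le> L2_set (\<lambda>i. K * norm (x i)) F"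
      by (rule L2_set_mono) (use K in \<open>auto simp: mult.commute\<close>)
    also have "\<dots> = K * L2_set (\<lambda>i. norm (x i)) F"
      by (rule L2_set_right_distrib[OF K(1), symmetric])
    also have "\<dots> \<le> K * l2norm x"
      by (intro mult_left_mono L2_set_le_l2norm x F K)
    finally show ?thesis .
  qed
  note l2 = l2_if_L2_set_le[OF this]
  have "bounded_by (op_diag d :: ('t, 'k, 'm, 'n) block_op) K"
    unfolding bounded_by_def op_apply_def
    using has_sum l2 by (auto simp: infsumI[OF has_sum] intro: has_sum_imp_summable)
  then show ?thesis by (auto simp: bounded_op_def)
qed

lemma op_mult_op_diag: "(A \<odot> op_diag d) i j = A i j ** d"
proof -
  have "((\<lambda>k. A i k ** op_diag d k j) has_sum A i j ** d) UNIV"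
    using has_sum_single[of j "\<lambda>k. A i k ** d"]
    by (rule has_sum_cong[THEN iffD1, rotated]) (auto simp: op_diag_def)
  then show ?thesis by (simp add: op_mult_def infsumI)
qed

lemma op_adj_op_diag: "op_adj (op_diag d) = op_diag (mat_adj d)"
  by (auto simp: fun_eq_iff op_adj_apply op_diag_def mat_adj_def vec_eq_iff scalar_conj_def)

lemma op_diag_mult: "op_diag d \<odot> op_diag e = op_diag (d ** e)"
  by (intro ext, subst op_mult_op_diag) (simp add: op_diag_def)

text \<open>With \<open>mat_Inr\<close>, the selection matrices \<open>(I 0)\<close> and
  \<open>(0 I)\<close> that split a stacked vector into its two parts.\<close>

definition mat_Inl :: "('k::{real_normed_field,euclidean_space})^('n::finite + 'm::finite)^'n" where
  "mat_Inl = (\<chi> a b. case b of Inl p \<Rightarrow> if a = p then 1 else 0 | Inr q \<Rightarrow> 0)"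

definition mat_Inr :: "('k::{real_normed_field,euclidean_space})^('n::finite + 'm::finite)^'m" where
  "mat_Inr = (\<chi> a b. case b of Inl p \<Rightarrow> 0 | Inr q \<Rightarrow> if a = q then 1 else 0)"

lemma sum_UNIV_Plus:
  "(\<Sum>s\<in>UNIV. f s) = (\<Sum>a\<in>UNIV. f (Inl a)) + (\<Sum>b\<in>UNIV. f (Inr b))"
  for f :: "'a::finite + 'b::finite \<Rightarrow> 'c::comm_monoid_add"
  unfolding UNIV_Plus_UNIV[symmetric] by (simp add: sum.Plus del: UNIV_Plus_UNIV)

lemma mat_Inl_Inr_adj:
  "mat_Inl ** mat_adj mat_Inl = mat 1" "mat_Inr ** mat_adj mat_Inr = mat 1"
  "mat_Inl ** mat_adj mat_Inr = 0" "mat_Inr ** mat_adj mat_Inl = 0"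
proof -
  have conj: "scalar_conj (if P then 1 else 0) = (if P then 1 else 0)" for P
    by (simp add: scalar_conj_def)
  have conj0: "scalar_conj 0 = 0"
    by (simp add: scalar_conj_def)
  show "mat_Inl ** mat_adj mat_Inl = mat 1" "mat_Inr ** mat_adj mat_Inr = mat 1"
    "mat_Inl ** mat_adj mat_Inr = 0" "mat_Inr ** mat_adj mat_Inl = 0"
    by (simp_all add: vec_eq_iff matrix_matrix_mult_def mat_Inl_def mat_Inr_def mat_adj_def mat_def
        sum_UNIV_Plus conj conj0 mult_delta_left)
qed

text \<open>In this form a block row inherits boundedness and its action from sums and
  products.\<close>

lemma block_row_eq: "block_row A B = A \<odot> op_diag mat_Inl + B \<odot> op_diag mat_Inr"
proof -
  have "A i j ** mat_Inl + B i j ** mat_Inr = block_row A B i j" for i j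
  proof -
    have "(A i j ** mat_Inl + B i j ** mat_Inr) $ a $ b = block_row A B i j $ a $ b" for a b
      by (cases b)
        (simp_all add: block_row_def matrix_matrix_mult_def mat_Inl_def mat_Inr_def if_distrib cong: if_cong)
    then show ?thesis by (simp add: vec_eq_iff)
  qed
  then show ?thesis by (intro ext) (simp add: op_mult_op_diag)
qed

section \<open>The regret operator\<close>

text \<open>Polarization expresses \<open>inner (D x) y\<close> by the quadratic form at
  \<open>x + y\<close> and \<open>x - y\<close>, and the parallelogram law bounds these values. The
  vector \<open>y\<close> is taken along \<open>D x\<close> with the norm of
  \<open>x\<close>.\<close>

lemma norm_le_if_quadratic_form_le:
  fixes D :: "'x::real_inner \<Rightarrow> 'x"
  assumes D: "linear D" and sym: "\<And>x y. inner (D x) y = inner x (D y)"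
    and le: "\<And>x. \<bar>inner (D x) x\<bar> \<le> c * (norm x)\<^sup>2" and c: "0 \<le> c"
  shows "norm (D x) \<le> c * norm x"
proof (cases "D x = 0 \<or> x = 0")
  case True
  then show ?thesis using c linear_0[OF D] by auto
next
  case False
  define y where "y = (norm x / norm (D x)) *\<^sub>R D x"
  have norm_y: "norm y = norm x" using False by (simp add: y_def)
  have "inner (D x) y = norm x * norm (D x)"
    using False by (simp add: y_def power2_norm_eq_inner[symmetric] power2_eq_square)
  moreover have "4 * inner (D x) y = inner (D (x + y)) (x + y) - inner (D (x - y)) (x - y)"
    by (simp add: linear_add[OF D] linear_diff[OF D] inner_add_left inner_add_right
        inner_diff_left inner_diff_right sym[of y x] inner_commute[of y "D x"])
  moreover have "\<dots> \<le> c * (norm (x + y))\<^sup>2 + c * (norm (x - y))\<^sup>2"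
    using le[of "x + y"] le[of "x - y"] by linarith
  moreover have "\<dots> = c * (2 * (norm x)\<^sup>2 + 2 * (norm y)\<^sup>2)"
    by (simp add: power2_norm_eq_inner inner_add_left inner_add_right inner_diff_left
        inner_diff_right inner_commute[of y x] algebra_simps)
  moreover have "\<dots> = 4 * (norm x * (c * norm x))"
    by (simp add: norm_y power2_eq_square)
  ultimately have "norm x * norm (D x) \<le> norm x * (c * norm x)"
    by linarith
  then show ?thesis using False by simp
qed

text \<open>
  The self-adjoint map \<open>D\<close> is, with respect to the decomposition of \<open>x\<close> into \<open>Us (U x)\<close> and a
  vector of the kernel of \<open>U\<close>, the block matrix with rows \<open>(M\<^sup>* M, - M\<^sup>* P)\<close> and \<open>(- P\<^sup>* M, 0)\<close>.
  Maximising the quadratic forms of \<open>D - c\<close> and \<open>- D - c\<close> over the kernel component gives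
  the Schur complement condition on the right.
\<close>

lemma norm_le_iff_schur_complement:
  fixes M :: "'y::real_inner \<Rightarrow> 's::real_inner" and P :: "'x::real_inner \<Rightarrow> 's"
  assumes U: "linear U" and Ps: "linear Ps" and D: "linear D"
    and adj_U: "\<And>x a. inner (U x) a = inner x (Us a)"
    and adj_P: "\<And>x b. inner (P x) b = inner x (Ps b)"
    and U_Us: "\<And>a. U (Us a) = a" and U_Ps: "\<And>b. U (Ps b) = 0"
    and sym: "\<And>x y. inner (D x) y = inner x (D y)"
    and quad: "\<And>x. inner (D x) x = (norm (M (U x)))\<^sup>2 - 2 * inner (P x) (M (U x))"
    and c: "0 < c"
  shows "(\<forall>x. norm (D x) \<le> c * norm x) \<longleftrightarrow>
    (\<forall>a. (norm (M a))\<^sup>2 + (norm (Ps (M a)))\<^sup>2 / c \<le> c * (norm a)\<^sup>2)"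
proof
  have orth: "inner (Us a) z = 0" if "U z = 0" for a z
    using adj_U[of z a] that by (simp add: inner_commute)
  have Us_norm: "inner (Us a) (Us a) = inner a a" for a
    using adj_U[of "Us a" a] by (simp add: U_Us)
  have pythagoras: "(norm (Us a + z))\<^sup>2 = (norm a)\<^sup>2 + (norm z)\<^sup>2" if "U z = 0" for a z
    using orth[OF that, of a]
    by (simp add: power2_norm_eq_inner inner_add_left inner_add_right inner_commute[of z "Us a"] Us_norm)
  {
    assume le: "\<forall>x. norm (D x) \<le> c * norm x"
    show "\<forall>a. (norm (M a))\<^sup>2 + (norm (Ps (M a)))\<^sup>2 / c \<le> c * (norm a)\<^sup>2"
    proof
      fix a
      define q where "q = Ps (M a)"
      \<comment> \<open>For \<open>z\<close> in the kernel of \<open>U\<close>, the part of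
        \<open>inner (D x) x - c * (norm x)\<^sup>2\<close> that depends on \<open>z\<close> is
        \<open>- 2 * inner z q - c * (norm z)\<^sup>2\<close>; completing the square shows that it
        is largest here.\<close>
      define z where "z = (- (1 / c)) *\<^sub>R q"
      define x where "x = Us a + z"
      have Uz: "U z = 0" by (simp add: z_def q_def linear_cmul[OF U] linear_neg[OF U] U_Ps)
      have Ux: "U x = a" by (simp add: x_def linear_add[OF U] U_Us Uz)
      have "inner (P x) (M a) = inner z q"
        using orth[of q a] by (simp add: adj_P x_def inner_add_left U_Ps flip: q_def)
          (simp add: q_def U_Ps)
      then have "inner (P x) (M a) = - ((norm q)\<^sup>2 / c)"
        by (simp add: z_def power2_norm_eq_inner)
      then have "(norm (M a))\<^sup>2 + 2 * ((norm q)\<^sup>2 / c) = inner (D x) x"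
        by (simp add: quad Ux)
      also have "\<dots> \<le> norm (D x) * norm x" by (rule norm_cauchy_schwarz)
      also have "\<dots> \<le> (c * norm x) * norm x" using le by (simp add: mult_right_mono)
      also have "\<dots> = c * ((norm a)\<^sup>2 + (norm z)\<^sup>2)"
        using pythagoras[OF Uz, of a] by (simp add: x_def power2_eq_square)
      also have "\<dots> = c * (norm a)\<^sup>2 + (norm q)\<^sup>2 / c"
        using c by (simp add: z_def power2_eq_square field_simps)
      finally show "(norm (M a))\<^sup>2 + (norm (Ps (M a)))\<^sup>2 / c \<le> c * (norm a)\<^sup>2"
        by (simp add: q_def)
    qed
  next
    assume le: "\<forall>a. (norm (M a))\<^sup>2 + (norm (Ps (M a)))\<^sup>2 / c \<le> c * (norm a)\<^sup>2"
    show "\<forall>x. norm (D x) \<le> c * norm x"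
    proof
      fix x
      show "norm (D x) \<le> c * norm x"
      proof (rule norm_le_if_quadratic_form_le[OF D sym _ less_imp_le[OF c]])
        fix x
        define a where "a = U x"
        \<comment> \<open>\<open>Us a\<close> is the component of \<open>x\<close> in the range of
          \<open>Us\<close>, and \<open>z\<close> is the remainder in the kernel of
          \<open>U\<close>.\<close>
        define z where "z = x - Us a"
        define q where "q = Ps (M a)"
        have x: "x = Us a + z" by (simp add: z_def)
        have Uz: "U z = 0" by (simp add: z_def a_def linear_diff[OF U] U_Us)
        have norm_x: "c * (norm x)\<^sup>2 = c * (norm a)\<^sup>2 + c * (norm z)\<^sup>2"
          unfolding x pythagoras[OF Uz] by (simp add: distrib_left)
        have "inner (P x) (M a) = inner z q"
          using orth[of q a] by (subst x) (simp add: adj_P q_def inner_add_left U_Ps)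
        then have quad': "inner (D x) x = (norm (M a))\<^sup>2 - 2 * inner z q"
          by (simp add: quad a_def)
        \<comment> \<open>Cauchy-Schwarz and Young's inequality with weight \<open>c\<close>: the
          term \<open>c * (norm z)\<^sup>2\<close> is absorbed by the kernel component of
          \<open>x\<close>.\<close>
        have "2 * \<bar>inner z q\<bar> \<le> 2 * (norm z * norm q)"
          using Cauchy_Schwarz_ineq2[of z q] by simp
        also have "\<dots> \<le> (norm q)\<^sup>2 / c + c * (norm z)\<^sup>2"
        proof -
          have "0 \<le> (norm q - c * norm z)\<^sup>2 / c" using c by simp
          then show ?thesis using c by (simp add: power2_diff field_simps power2_eq_square)
        qed
        finally have "2 * \<bar>inner z q\<bar> \<le> (norm q)\<^sup>2 / c + c * (norm z)\<^sup>2" .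
        moreover have "(norm (M a))\<^sup>2 + (norm q)\<^sup>2 / c \<le> c * (norm a)\<^sup>2"
          using le by (simp add: q_def)
        \<comment> \<open>The upper bound uses all of the hypothesis, the lower bound only
          \<open>(norm q)\<^sup>2 / c \<le> c * (norm a)\<^sup>2\<close>.\<close>
        ultimately show "\<bar>inner (D x) x\<bar> \<le> c * (norm x)\<^sup>2"
          unfolding quad' norm_x using zero_le_power2[of "norm (M a)"] by linarith
      qed
    qed
  }
qed

section \<open>Existence of a Nehari minimiser\<close>

text \<open>Tychonoff's theorem, moved to the topology of the function type.\<close>

lemma compact_Pi_UNIV:
  fixes S :: "'i \<Rightarrow> 'a::topological_space set"
  assumes "\<And>i. compact (S i)" shows "compact (Pi UNIV S)"
proof -
  have "compactin (product_topology (\<lambda>i::'i. euclidean :: 'a topology) UNIV) (PiE UNIV S)"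
    using assms by (simp add: compactin_PiE compactin_euclidean_iff)
  then show ?thesis
    by (simp add: PiE_UNIV_domain euclidean_product_topology compactin_euclidean_iff)
qed

text \<open>The constant is crude: each entry is at most \<open>c\<close>, and the norms of the rows
  and of the matrix are bounded by sums. It serves as a radius in the compactness argument.\<close>

lemma norm_matrix_le:
  fixes M :: "('k::{real_normed_field,euclidean_space})^'n::finite^'m::finite"
  assumes "\<And>v. norm (M *v v) \<le> c * norm v"
  shows "norm M \<le> real CARD('m) * (real CARD('n) * c)"
proof -
  have "norm (M $ p $ q) \<le> c" for p q
  proof -
    have "norm (M $ p $ q) = norm ((M *v axis q 1) $ p)"
      by (simp add: matrix_vector_mult_def axis_def if_distrib cong: if_cong)
    also have "\<dots> \<le> norm (M *v axis q 1)" by (rule Finite_Cartesian_Product.norm_nth_le)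
    also have "\<dots> \<le> c * norm (axis q 1 :: 'k^'n)" by (rule assms)
    also have "norm (axis q 1 :: 'k^'n) = norm (1 :: 'k)"
      unfolding norm_eq_sqrt_inner by (simp add: inner_axis_axis)
    finally show ?thesis by simp
  qed
  then have "norm (M $ p) \<le> real CARD('n) * c" for p
    unfolding norm_vec_def[of "M $ p"]
    by (intro order.trans[OF L2_set_le_sum] order.trans[OF sum_bounded_above]) auto
  then show ?thesis
    unfolding norm_vec_def[of M]
    by (intro order.trans[OF L2_set_le_sum] order.trans[OF sum_bounded_above]) auto
qed

lemma form_bound_norm_entry:
  assumes A: "form_bound A c" and c: "0 \<le> c" shows "norm (A i j *v v) \<le> c * norm v"
proof -
  have "norm (A i j *v v) * norm (A i j *v v) \<le> (c * norm v) * norm (A i j *v v)"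
    using form_boundD[OF A, of "{i}" "{j}" "\<lambda>_. v" "\<lambda>_. A i j *v v"]
    by (simp add: L2_set_def power2_norm_eq_inner[symmetric] power2_eq_square mult.assoc)
  then show ?thesis using c by (cases "A i j *v v = 0") auto
qed

text \<open>
  The near-minimisers form closed sets in the topology of entrywise convergence, all contained in a
  product of balls; this product is compact by Tychonoff's theorem.
\<close>

lemma causal_arg_min_opnorm_diff:
  fixes Z :: "('t::linorder, 'k::{real_normed_field,euclidean_space}, 'm::finite, 'n::finite) block_op"
  shows "\<exists>K. is_arg_min (\<lambda>K. opnorm (Z - K)) causal K"
proof (cases "(INF K\<in>Collect causal. opnorm (Z - K)) = \<infinity>")
  case True
  then have "opnorm (Z - K) = \<infinity>" if "causal K" for K
    using INF_lower[of K "Collect causal" "\<lambda>K. opnorm (Z - K)"] that by (simp add: top_unique)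
  \<comment> \<open>Every causal block matrix is minimal when all the norms are infinite;
    \<open>0\<close> is one.\<close>
  then have "is_arg_min (\<lambda>K. opnorm (Z - K)) causal 0"
    by (auto simp: is_arg_min_def causal_def)
  then show ?thesis by blast
next
  case False
  then obtain a where a: "0 \<le> a" "(INF K\<in>Collect causal. opnorm (Z - K)) = ennreal a"
    by (cases "INF K\<in>Collect causal. opnorm (Z - K)" rule: ennreal_cases) auto
  define S where "S e = {K. causal K \<and> form_bound (Z - K) (a + e)}" for e
  have S_nonempty: "\<exists>K. K \<in> S e" if "0 < e" for e
  proof -
    have "(INF K\<in>Collect causal. opnorm (Z - K)) < ennreal (a + e)"
      using a that by (simp add: ennreal_less_iff)
    then obtain K where "causal K" "opnorm (Z - K) < ennreal (a + e)"
      by (auto simp: INF_less_iff)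
    then have "causal K" "bounded_by (Z - K) (a + e)"
      using a that opnorm_le_iff[of "a + e"] less_imp_le by auto
    then show ?thesis by (auto simp: S_def bounded_by_imp_form_bound)
  qed
  have S_mono: "S d \<subseteq> S e" if "0 < d" "d \<le> e" for d e
    using that a bounded_by_mono[of _ "a + d" "a + e"]
    by (auto simp: S_def simp flip: bounded_by_iff_form_bound)
  have continuous: "continuous_on UNIV (\<lambda>K :: 't \<Rightarrow> 't \<Rightarrow> 'k^'n^'m. K i j)" for i j
    by (rule continuous_on_compose2[OF continuous_on_product_coordinates continuous_on_product_coordinates]) simp
  have S_closed: "closed (S e)" for e
  proof -
    have "closed {K :: ('t, 'k, 'm, 'n) block_op. causal K}"
      unfolding causal_def
      by (intro closed_Collect_all closed_Collect_imp closed_Collect_eq continuous continuous_on_const open_Collect_const)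
    \<comment> \<open>Each inequality in \<open>form_bound\<close> involves finitely many entries
      and is therefore a closed condition.\<close>
    moreover have "closed {K. form_bound (Z - K) (a + e)}"
      unfolding form_bound_def
      by (intro closed_Collect_all closed_Collect_imp closed_Collect_le continuous_on_const open_Collect_const
          continuous_on_sum continuous_on_inner
          bounded_linear.continuous_on[OF bounded_linear_matrix_vector_left])
        (simp add: continuous_on_diff continuous)
    ultimately show ?thesis unfolding S_def by (simp add: closed_Collect_conj)
  qed
  \<comment> \<open>The radius is the bound of \<open>norm_matrix_le\<close> for the entries of
    \<open>Z - K\<close> with \<open>K \<in> S 1\<close>.\<close>
  define B where "B = Pi UNIV (\<lambda>i. Pi UNIV (\<lambda>j. cball (Z i j) (real CARD('m) * (real CARD('n) * (a + 1)))))"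
  have "compact B" unfolding B_def by (intro compact_Pi_UNIV compact_cball)
  have S_B: "S e \<subseteq> B" if "0 < e" "e \<le> 1" for e
  proof -
    have "dist (Z i j) (K i j) \<le> real CARD('m) * (real CARD('n) * (a + 1))" if "K \<in> S 1" for K i j
      using norm_matrix_le[OF form_bound_norm_entry[of "Z - K" "a + 1" i j]] that a
      by (simp add: S_def dist_norm)
    then have "S 1 \<subseteq> B" by (auto simp: B_def)
    then show ?thesis using S_mono[OF that] by blast
  qed
  have "B \<inter> \<Inter> (S ` {0<..}) \<noteq> {}"
  proof (rule compact_imp_fip[OF \<open>compact B\<close>])
    fix T assume "T \<in> S ` {0<..}"
    then show "closed T" using S_closed by blast
  next
    fix \<F> assume "finite \<F>" "\<F> \<subseteq> S ` {0<..}"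
    then obtain E where E: "finite E" "E \<subseteq> {0<..}" "\<F> = S ` E"
      by (meson finite_subset_image)
    \<comment> \<open>Inserting \<open>1\<close> makes the minimum exist for empty \<open>E\<close>
      and keeps \<open>m \<le> 1\<close>, as \<open>S_B\<close> requires. By monotonicity
      \<open>S m\<close> lies in all the chosen sets.\<close>
    define m where "m = Min (insert 1 E)"
    have m: "0 < m" "m \<le> 1" "\<And>e. e \<in> E \<Longrightarrow> m \<le> e" using E by (auto simp: m_def)
    obtain K where K: "K \<in> S m" using S_nonempty[OF m(1)] ..
    have "K \<in> B" using S_B[OF m(1,2)] K by blast
    moreover have "K \<in> S e" if "e \<in> E" for e using S_mono[OF m(1) m(3)[OF that]] K by blast
    ultimately show "B \<inter> \<Inter>\<F> \<noteq> {}" using E(3) by blast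
  qed
  then obtain K where K: "\<And>e. 0 < e \<Longrightarrow> K \<in> S e" by auto
  have le: "opnorm (Z - K) \<le> ennreal a"
  proof (rule ennreal_le_epsilon)
    fix e :: real assume e: "0 < e"
    then have "opnorm (Z - K) \<le> ennreal (a + e)"
      using K[OF e] a by (simp add: S_def opnorm_le_iff bounded_by_iff_form_bound del: ennreal_plus)
    then show "opnorm (Z - K) \<le> ennreal a + ennreal e" using a e by simp
  qed
  have "opnorm (Z - K) \<le> opnorm (Z - K')" if "causal K'" for K'
    by (rule order.trans[OF le], unfold a(2)[symmetric], rule INF_lower) (simp add: that)
  then have "is_arg_min (\<lambda>K. opnorm (Z - K)) causal K"
    using K[of 1] by (auto simp: is_arg_min_def S_def not_less)
  then show ?thesis by blast
qed

section \<open>Causal estimation\<close>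

lemma inner_opf_op_adj:
  assumes "bounded_op A" shows "inner (opf (op_adj A) x) y = inner x (opf A y)"
  using inner_opf[OF assms, of y x] by (simp add: inner_commute)

lemma inner_eqI: "(\<And>z. inner x z = inner y z) \<Longrightarrow> x = y" for x y :: "'a::real_inner"
  using inner_eq_zero_iff[of "x - y"] by (simp add: inner_diff_left)

text \<open>Collects the data that do not depend on \<open>\<gamma>\<close>; the factor
  \<open>Nabla \<gamma>\<close> enters the lemmas as a separate \<open>N\<close>.\<close>

locale estimation_problem =
  fixes H :: "('t::linorder, 'k::{real_normed_field,euclidean_space}, 'y::finite, 'w::finite) block_op"
    and L :: "('t, 'k, 's::finite, 'w) block_op"
    and \<Delta> :: "('t, 'k, 'y, 'y) block_op"
  assumes bounded_H: "bounded_op H" and bounded_L: "bounded_op L"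
    and factor: "canonical_factor \<Delta>"
    and factorization: "\<Delta> \<odot> op_adj \<Delta> = op_id + H \<odot> op_adj H"
begin

text \<open>The inverse of \<open>op_id + H \<odot> op_adj H\<close>, built from
  \<open>op_inv \<Delta>\<close> so that its boundedness is immediate.\<close>

definition R :: "('t, 'k, 'y, 'y) block_op" where
  "R = op_adj (op_inv \<Delta>) \<odot> op_inv \<Delta>"

abbreviation K0 :: "('t, 'k, 's, 'y) block_op" where
  "K0 \<equiv> noncausal_estimator H L"

text \<open>
  With \<open>V = (H I)\<close> one has \<open>T\<^sub>K = (L 0) - K V\<close> and \<open>V V\<^sup>* = \<Delta> \<Delta>\<^sup>*\<close>; below, \<open>P = T\<^bsub>K0\<^esub>\<close>.
\<close>

definition V :: "('t, 'k, 'y, 'w + 'y) block_op" where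
  "V = H \<odot> op_diag mat_Inl + op_diag mat_Inr"

abbreviation P :: "('t, 'k, 's, 'w + 'y) block_op" where
  "P \<equiv> error_op H L K0"

lemma bounded_factor:
  "bounded_op \<Delta>" "causal \<Delta>" "bounded_op (op_inv \<Delta>)" "causal (op_inv \<Delta>)"
  using canonical_factorE[OF factor] by blast+

lemmas bounded_intros [simp, intro!] =
  bounded_H bounded_L bounded_factor(1,3) bounded_op_op_diag bounded_op_intros

lemma inv_factor: "\<Delta> \<odot> op_inv \<Delta> = op_id" "op_inv \<Delta> \<odot> \<Delta> = op_id"
  using canonical_factorE[OF factor] by blast+

lemma opf_inv_factor:
  "opf \<Delta> (opf (op_inv \<Delta>) x) = x" "opf (op_inv \<Delta>) (opf \<Delta> x) = x"
  using inv_factor by (simp_all flip: opf_mult add: opf_id)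

lemma opf_adj_inv_factor:
  "opf (op_adj \<Delta>) (opf (op_adj (op_inv \<Delta>)) x) = x"
  "opf (op_adj (op_inv \<Delta>)) (opf (op_adj \<Delta>) x) = x"
  by (rule inner_eqI, simp add: inner_opf_op_adj opf_inv_factor)+

lemma opf_factorization: "opf \<Delta> (opf (op_adj \<Delta>) x) = x + opf H (opf (op_adj H) x)"
  using arg_cong[OF factorization, of "\<lambda>A. opf A x"] by (simp add: opf_mult opf_add opf_id)

lemma bounded_R [simp, intro!]: "bounded_op R"
  by (simp add: R_def)

lemma opf_R: "opf R x = opf (op_adj (op_inv \<Delta>)) (opf (op_inv \<Delta>) x)"
  by (simp add: R_def opf_mult)

lemma inner_R: "inner (opf R x) y = inner x (opf R y)"
  by (simp add: opf_R inner_opf_op_adj) (simp add: inner_opf)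

lemma opf_R_inverse:
  "opf R x + opf H (opf (op_adj H) (opf R x)) = x"
  "opf R (x + opf H (opf (op_adj H) x)) = x"
  unfolding opf_factorization[symmetric]
  by (simp_all add: opf_R opf_adj_inv_factor opf_inv_factor)

lemma inv_R: "op_inv (op_id + H \<odot> op_adj H) = R"
proof (rule op_inv_eqI)
  show "is_op_inverse (op_id + H \<odot> op_adj H) R"
    unfolding is_op_inverse_def
    by (intro conjI block_op_eqI) (simp_all add: opf_mult opf_add opf_id opf_R_inverse)
qed simp

lemma noncausal_estimator_eq: "K0 = L \<odot> op_adj H \<odot> R"
  by (simp add: noncausal_estimator_def inv_R)

lemma bounded_K0 [simp, intro!]: "bounded_op K0"
  by (simp add: noncausal_estimator_eq)

lemma opf_K0: "opf K0 x = opf L (opf (op_adj H) (opf R x))"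
  by (simp add: noncausal_estimator_eq opf_mult)

text \<open>The Woodbury identity; it reduces this inverse to \<open>R\<close> and so supplies its
  existence and boundedness. The two products are checked by applying \<open>op_adj H\<close> to the
  two inverse relations of \<open>R\<close> at \<open>opf H x\<close>.\<close>

lemma inv_adj_H_H: "op_inv (op_id + op_adj H \<odot> H) = op_id - op_adj H \<odot> (R \<odot> H)" (is "_ = ?W")
proof (rule op_inv_eqI)
  have 1: "opf (op_adj H) (opf R (opf H x)) + opf (op_adj H) (opf H (opf (op_adj H) (opf R (opf H x))))
      = opf (op_adj H) (opf H x)" for x
    using arg_cong[OF opf_R_inverse(1)[of "opf H x"], of "opf (op_adj H)"]
    by (simp add: linear_add[OF linear_opf])
  have 2: "opf (op_adj H) (opf R (opf H x)) + opf (op_adj H) (opf R (opf H (opf (op_adj H) (opf H x))))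
      = opf (op_adj H) (opf H x)" for x
    using arg_cong[OF opf_R_inverse(2)[of "opf H x"], of "opf (op_adj H)"]
    by (simp add: linear_add[OF linear_opf])
  show "is_op_inverse (op_id + op_adj H \<odot> H) ?W"
    unfolding is_op_inverse_def
  proof (intro conjI block_op_eqI)
    show "opf ((op_id + op_adj H \<odot> H) \<odot> ?W) x = opf op_id x" for x
      using 1[of x] by (simp add: opf_mult opf_add opf_diff opf_id linear_diff[OF linear_opf] algebra_simps)
    show "opf (?W \<odot> (op_id + op_adj H \<odot> H)) x = opf op_id x" for x
      using 2[of x] by (simp add: opf_mult opf_add opf_diff opf_id linear_add[OF linear_opf] algebra_simps)
  qed simp_all
qed simp

section \<open>Action of the stacked operators \<open>V\<close> and \<open>P\<close>\<close>

lemma opf_Inl_Inr: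
  fixes x :: "('t, 'k^'w) ell2" and y :: "('t, 'k^'y) ell2"
  shows "opf (op_diag mat_Inl) (opf (op_adj (op_diag (mat_Inl :: 'k^('w + 'y)^'w))) x) = x"
    and "opf (op_diag mat_Inr) (opf (op_adj (op_diag (mat_Inr :: 'k^('w + 'y)^'y))) y) = y"
    and "opf (op_diag mat_Inl) (opf (op_adj (op_diag (mat_Inr :: 'k^('w + 'y)^'y))) y) = (0 :: ('t, 'k^'w) ell2)"
    and "opf (op_diag mat_Inr) (opf (op_adj (op_diag (mat_Inl :: 'k^('w + 'y)^'w))) x) = (0 :: ('t, 'k^'y) ell2)"
proof -
  have [simp]: "op_diag (mat 1 :: 'k^'n^'n) = (op_id :: ('t, 'k, 'n::finite, 'n) block_op)"
    by (simp add: op_diag_def op_id_def)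
  have [simp]: "opf (op_diag (0 :: 'k^'n^'m)) z = (0 :: ('t, 'k^'m) ell2)"
    for z :: "('t, 'k^'n::finite) ell2"
    using opf_diff[OF bounded_op_op_diag bounded_op_op_diag, of "0 :: 'k^'n^'m" "0 :: 'k^'n^'m" z]
    by (simp add: op_diag_def fun_diff_def zero_fun_def)
  show "opf (op_diag mat_Inl) (opf (op_adj (op_diag (mat_Inl :: 'k^('w + 'y)^'w))) x) = x"
    "opf (op_diag mat_Inr) (opf (op_adj (op_diag (mat_Inr :: 'k^('w + 'y)^'y))) y) = y"
    "opf (op_diag mat_Inl) (opf (op_adj (op_diag (mat_Inr :: 'k^('w + 'y)^'y))) y) = (0 :: ('t, 'k^'w) ell2)"
    "opf (op_diag mat_Inr) (opf (op_adj (op_diag (mat_Inl :: 'k^('w + 'y)^'w))) x) = (0 :: ('t, 'k^'y) ell2)"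
    by (simp_all flip: opf_mult add: op_adj_op_diag op_diag_mult mat_Inl_Inr_adj opf_id)
qed

lemma bounded_V [simp, intro!]: "bounded_op V"
  by (simp add: V_def)

lemma opf_V: "opf V x = opf H (opf (op_diag mat_Inl) x) + opf (op_diag mat_Inr) x"
  by (simp add: V_def opf_add opf_mult)

lemma opf_V_Inl: "opf V (opf (op_adj (op_diag mat_Inl)) x) = opf H x"
  by (simp add: opf_V opf_Inl_Inr)

lemma opf_adj_V:
  "opf (op_adj V) x = opf (op_adj (op_diag mat_Inl)) (opf (op_adj H) x) + opf (op_adj (op_diag mat_Inr)) x"
  by (rule inner_eqI) (simp add: inner_opf_op_adj inner_add_left opf_V inner_add_right)

lemma opf_V_adj_V: "opf V (opf (op_adj V) x) = x + opf H (opf (op_adj H) x)"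
  by (simp add: opf_adj_V opf_V linear_add[OF linear_opf] opf_Inl_Inr)

lemma
  assumes [simp]: "bounded_op K"
  shows bounded_error_op: "bounded_op (error_op H L K)"
    and opf_error_op: "opf (error_op H L K) x = opf L (opf (op_diag mat_Inl) x) - opf K (opf V x)"
proof -
  have uminus: "- K = op_scale (- 1) K" by (simp add: op_scale_def fun_eq_iff)
  show "bounded_op (error_op H L K)"
    by (simp add: error_op_def block_row_eq uminus)
  show "opf (error_op H L K) x = opf L (opf (op_diag mat_Inl) x) - opf K (opf V x)"
    by (simp add: error_op_def block_row_eq uminus opf_add opf_mult opf_diff opf_scale opf_V
        linear_add[OF linear_opf])
qed

lemma bounded_P [simp, intro!]: "bounded_op P"
  by (simp add: bounded_error_op)

text \<open>The normal equations: \<open>P \<odot> op_adj V\<close> is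
  \<open>L \<odot> op_adj H - K0 \<odot> (op_id + H \<odot> op_adj H)\<close>, which vanishes
  because the factor \<open>R\<close> of \<open>K0\<close> inverts the bracket.\<close>

lemma opf_P_adj_V: "opf P (opf (op_adj V) x) = 0"
proof -
  have "opf (op_diag mat_Inl) (opf (op_adj V) x) = opf (op_adj H) x"
    by (simp add: opf_adj_V linear_add[OF linear_opf] opf_Inl_Inr)
  then show ?thesis
    by (simp add: opf_error_op opf_V_adj_V opf_K0 opf_R_inverse)
qed

lemma opf_V_adj_P: "opf V (opf (op_adj P) b) = 0"
proof (rule inner_eqI)
  fix z
  have "inner (opf V (opf (op_adj P) b)) z = inner b (opf P (opf (op_adj V) z))"
    by (simp add: inner_opf[of V] inner_opf_op_adj)
  then show "inner (opf V (opf (op_adj P) b)) z = inner 0 z" by (simp add: opf_P_adj_V)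
qed

text \<open>By \<open>opf_V_adj_P\<close> the summand with \<open>K0\<close> in the outer
  \<open>P\<close> drops out, so only \<open>L\<close> applied to the \<open>w\<close>-part of
  \<open>opf (op_adj P) b\<close> remains. That part is computed by duality and matched with the
  Woodbury form of the inverse.\<close>

lemma opf_P_adj_P:
  "opf P (opf (op_adj P) b) = opf (L \<odot> op_inv (op_id + op_adj H \<odot> H) \<odot> op_adj L) b"
proof -
  have "opf (op_diag mat_Inl) (opf (op_adj P) b)
      = opf (op_adj L) b - opf (op_adj H) (opf R (opf H (opf (op_adj L) b)))"
  proof (rule inner_eqI)
    fix z
    have "inner (opf (op_diag mat_Inl) (opf (op_adj P) b)) z
        = inner b (opf P (opf (op_adj (op_diag mat_Inl)) z))"
      by (simp add: inner_opf[of "op_diag mat_Inl"] inner_opf_op_adj)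
    also have "\<dots> = inner b (opf L z - opf L (opf (op_adj H) (opf R (opf H z))))"
      by (simp add: opf_error_op opf_V_Inl opf_Inl_Inr opf_K0)
    also have "\<dots> = inner (opf (op_adj L) b - opf (op_adj H) (opf R (opf H (opf (op_adj L) b)))) z"
      by (simp add: inner_diff_left inner_diff_right inner_opf_op_adj inner_R inner_opf[of H])
    finally show "inner (opf (op_diag mat_Inl) (opf (op_adj P) b)) z
        = inner (opf (op_adj L) b - opf (op_adj H) (opf R (opf H (opf (op_adj L) b)))) z" .
  qed
  then show ?thesis
    by (simp add: opf_error_op opf_V_adj_P linear_0[OF linear_opf] inv_adj_H_H opf_mult opf_diff opf_id)
qed

section \<open>Regret bounds as contraction conditions\<close>

lemma regret_le_iff:
  assumes K [simp]: "bounded_op K" and c: "0 < c"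
  shows "regret H L K \<le> ennreal c \<longleftrightarrow>
    (\<forall>a. (norm (opf ((K - K0) \<odot> \<Delta>) a))\<^sup>2 + (norm (opf (op_adj P) (opf ((K - K0) \<odot> \<Delta>) a)))\<^sup>2 / c
      \<le> c * (norm a)\<^sup>2)"
proof -
  let ?T = "error_op H L K"
  let ?M = "opf ((K - K0) \<odot> \<Delta>)"
  let ?U = "\<lambda>x. opf (op_inv \<Delta>) (opf V x)"
  let ?Us = "\<lambda>a. opf (op_adj V) (opf (op_adj (op_inv \<Delta>)) a)"
  let ?D = "op_adj ?T \<odot> ?T - op_adj P \<odot> P"
  note [simp] = bounded_error_op
  have D: "opf ?D x = opf (op_adj ?T) (opf ?T x) - opf (op_adj P) (opf P x)" for x
    by (simp add: opf_diff opf_mult)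
  \<comment> \<open>The factor \<open>\<Delta>\<close> in \<open>?M\<close> cancels
    \<open>op_inv \<Delta>\<close> in \<open>?U\<close>, leaving
    \<open>(K - K0) \<odot> V\<close>.\<close>
  have MU: "opf ?T x = opf P x - ?M (?U x)" for x
    by (simp add: opf_error_op opf_mult opf_diff opf_inv_factor)
  have "regret H L K \<le> ennreal c \<longleftrightarrow> (\<forall>x. norm (opf ?D x) \<le> c * norm x)"
    using c by (simp add: regret_def opnorm_le_iff bounded_by_iff_norm_opf)
  also have "\<dots> \<longleftrightarrow> (\<forall>a. (norm (?M a))\<^sup>2 + (norm (opf (op_adj P) (?M a)))\<^sup>2 / c \<le> c * (norm a)\<^sup>2)"
  proof (rule norm_le_iff_schur_complement[where U = ?U and Us = ?Us and P = "opf P"])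
    show "linear ?U"
      using linear_compose[OF linear_opf linear_opf, of V "op_inv \<Delta>"] by (simp add: o_def)
    show "linear (opf (op_adj P))" "linear (opf ?D)"
      by (intro linear_opf; simp)+
    show "inner (?U x) a = inner x (?Us a)" for x a
      by (simp add: inner_opf)
    show "inner (opf P x) b = inner x (opf (op_adj P) b)" for x b
      by (simp add: inner_opf[of P])
    \<comment> \<open>\<open>V \<odot> op_adj V\<close> is
      \<open>\<Delta> \<odot> op_adj \<Delta>\<close>, and the two inverse factors cancel
      it.\<close>
    show "?U (?Us a) = a" for a
      by (simp add: opf_V_adj_V opf_adj_inv_factor opf_inv_factor flip: opf_factorization)
    show "?U (opf (op_adj P) b) = 0" for b
      by (simp add: opf_V_adj_P linear_0[OF linear_opf])
    show "inner (opf ?D x) y = inner x (opf ?D y)" for x y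
      by (simp add: D inner_diff_left inner_diff_right inner_opf_op_adj)
        (simp add: inner_opf[of ?T] inner_opf[of P])
    \<comment> \<open>By \<open>MU\<close> this is the expansion of
      \<open>(norm (opf ?T x))\<^sup>2 - (norm (opf P x))\<^sup>2\<close>.\<close>
    show "inner (opf ?D x) x = (norm (?M (?U x)))\<^sup>2 - 2 * inner (opf P x) (?M (?U x))" for x
      by (simp add: D inner_diff_left inner_opf_op_adj)
        (simp add: MU inner_diff_left inner_diff_right power2_norm_eq_inner inner_commute)
  qed (rule c)
  finally show ?thesis .
qed

text \<open>The factorization and \<open>opf_P_adj_P\<close> are read as quadratic forms. Up to the
  factor \<open>\<gamma>\<^sup>2\<close>, the result is the left side of the condition in
  \<open>regret_le_iff\<close> for \<open>c = \<gamma>\<^sup>2\<close>, with \<open>b\<close> a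
  value of \<open>(K - K0) \<odot> \<Delta>\<close>.\<close>

lemma norm_spectral_factor:
  assumes N: "bounded_op N"
    and factorization: "op_adj N \<odot> N = op_scale (1 / \<gamma>\<^sup>2)
        (op_id + op_scale (1 / \<gamma>\<^sup>2) (L \<odot> op_inv (op_id + op_adj H \<odot> H) \<odot> op_adj L))"
  shows "(norm (opf N b))\<^sup>2 = ((norm b)\<^sup>2 + (norm (opf (op_adj P) b))\<^sup>2 / \<gamma>\<^sup>2) / \<gamma>\<^sup>2"
proof -
  let ?Q = "L \<odot> op_inv (op_id + op_adj H \<odot> H) \<odot> op_adj L"
  have [simp]: "bounded_op ?Q" by (simp add: inv_adj_H_H)
  have "(norm (opf N b))\<^sup>2 = inner (opf (op_adj N \<odot> N) b) b"
    using N by (simp add: opf_mult inner_opf_op_adj power2_norm_eq_inner bounded_op_adj)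
  also have "\<dots> = (inner b b + inner (opf ?Q b) b / \<gamma>\<^sup>2) / \<gamma>\<^sup>2"
    unfolding factorization by (simp add: opf_scale opf_add opf_id inner_add_left del: bounded_intros(8))
  also have "inner (opf ?Q b) b = (norm (opf (op_adj P) b))\<^sup>2"
    unfolding opf_P_adj_P[symmetric] by (simp add: inner_opf[of P] power2_norm_eq_inner)
  finally show ?thesis by (simp add: power2_norm_eq_inner)
qed

text \<open>The criterion of \<open>regret_le_iff\<close> divided by
  \<open>\<gamma>\<^sup>2\<close>. The first part admits all
  \<open>c \<le> \<gamma>\<^sup>2\<close>, because optimality requires that a regret below
  \<open>\<gamma>\<^sup>2\<close> yields a constant below \<open>1\<close>.\<close>

lemma
  assumes N: "canonical_factor N" and \<gamma>: "0 < \<gamma>"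
    and factorization: "op_adj N \<odot> N = op_scale (1 / \<gamma>\<^sup>2)
        (op_id + op_scale (1 / \<gamma>\<^sup>2) (L \<odot> op_inv (op_id + op_adj H \<odot> H) \<odot> op_adj L))"
    and K [simp]: "bounded_op K"
  shows regret_le_imp_bounded_by: "regret H L K \<le> ennreal c \<Longrightarrow> 0 < c \<Longrightarrow> c \<le> \<gamma>\<^sup>2 \<Longrightarrow>
      bounded_by (N \<odot> K0 \<odot> \<Delta> - N \<odot> K \<odot> \<Delta>) (sqrt c / \<gamma>)"
    and bounded_by_imp_regret_le: "bounded_by (N \<odot> K0 \<odot> \<Delta> - N \<odot> K \<odot> \<Delta>) 1 \<Longrightarrow> regret H L K \<le> ennreal (\<gamma>\<^sup>2)"
proof -
  let ?M = "opf ((K - K0) \<odot> \<Delta>)"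
  have [simp]: "bounded_op N" using canonical_factorE[OF N] by blast
  note norm_N = norm_spectral_factor[OF \<open>bounded_op N\<close> factorization]
  have norm_eq: "norm (opf (N \<odot> K0 \<odot> \<Delta> - N \<odot> K \<odot> \<Delta>) a) = norm (opf N (?M a))" for a
    by (simp add: opf_diff opf_mult linear_diff[OF linear_opf] norm_minus_commute)
  show "bounded_by (N \<odot> K0 \<odot> \<Delta> - N \<odot> K \<odot> \<Delta>) (sqrt c / \<gamma>)"
    if regret: "regret H L K \<le> ennreal c" and c: "0 < c" "c \<le> \<gamma>\<^sup>2"
  proof (rule bounded_byI)
    fix a
    \<comment> \<open>\<open>N\<close> carries the weight \<open>1 / \<gamma>\<^sup>2\<close>
      instead of \<open>1 / c\<close>; as \<open>c \<le> \<gamma>\<^sup>2\<close>, the exchange does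
      not raise the left side.\<close>
    have "(norm (?M a))\<^sup>2 + (norm (opf (op_adj P) (?M a)))\<^sup>2 / \<gamma>\<^sup>2
        \<le> (norm (?M a))\<^sup>2 + (norm (opf (op_adj P) (?M a)))\<^sup>2 / c"
      using c \<gamma> by (intro add_left_mono divide_left_mono) auto
    also have "\<dots> \<le> c * (norm a)\<^sup>2"
      using regret_le_iff[OF K c(1)] regret by blast
    finally have "(norm (opf N (?M a)))\<^sup>2 \<le> c * (norm a)\<^sup>2 / \<gamma>\<^sup>2"
      unfolding norm_N by (rule divide_right_mono) simp
    also have "\<dots> = (sqrt c / \<gamma> * norm a)\<^sup>2"
      using c by (simp add: power_mult_distrib power_divide)
    finally show "norm (opf (N \<odot> K0 \<odot> \<Delta> - N \<odot> K \<odot> \<Delta>) a) \<le> sqrt c / \<gamma> * norm a"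
      unfolding norm_eq by (rule power2_le_imp_le) (use c \<gamma> in simp)
  qed simp
  show "regret H L K \<le> ennreal (\<gamma>\<^sup>2)" if "bounded_by (N \<odot> K0 \<odot> \<Delta> - N \<odot> K \<odot> \<Delta>) 1"
    unfolding regret_le_iff[OF K zero_less_power[OF \<gamma>]]
  proof
    fix a
    have "(norm (opf N (?M a)))\<^sup>2 \<le> (norm a)\<^sup>2"
      using norm_opf_le[OF that, of a] unfolding norm_eq by (simp add: power_mono)
    then show "(norm (?M a))\<^sup>2 + (norm (opf (op_adj P) (?M a)))\<^sup>2 / \<gamma>\<^sup>2 \<le> \<gamma>\<^sup>2 * (norm a)\<^sup>2"
      unfolding norm_N using \<gamma> by (simp add: pos_divide_le_eq mult.commute)
  qed
qed

text \<open>Subtracting the causal part of \<open>X = N \<odot> K0 \<odot> \<Delta>\<close> from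
  \<open>N \<odot> K \<odot> \<Delta>\<close> gives a causal \<open>K'\<close> for which
  \<open>anticausal_part X - K'\<close> is exactly
  \<open>X - N \<odot> K \<odot> \<Delta>\<close>.\<close>

lemma nehari_norm_causal_estimator:
  assumes N: "canonical_factor N" and \<gamma>: "0 < \<gamma>"
    and factorization: "op_adj N \<odot> N = op_scale (1 / \<gamma>\<^sup>2)
        (op_id + op_scale (1 / \<gamma>\<^sup>2) (L \<odot> op_inv (op_id + op_adj H \<odot> H) \<odot> op_adj L))"
    and K: "bounded_op K" "causal K"
    and regret: "regret H L K \<le> ennreal c" and c: "0 < c" "c \<le> \<gamma>\<^sup>2"
  shows "\<exists>K'. causal K' \<and> nehari_norm (N \<odot> K0 \<odot> \<Delta>) K' \<le> ennreal (sqrt c / \<gamma>)"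
proof (intro exI conjI)
  let ?X = "N \<odot> K0 \<odot> \<Delta>"
  let ?K' = "N \<odot> K \<odot> \<Delta> - causal_part ?X"
  have "causal N" using canonical_factorE[OF N] by blast
  then show "causal ?K'"
    by (intro causal_diff causal_op_mult causal_causal_part K bounded_factor)
  have diff: "anticausal_part ?X - ?K' = ?X - N \<odot> K \<odot> \<Delta>"
    using causal_part_add_anticausal_part[of ?X] by (simp add: algebra_simps)
  then show "nehari_norm ?X ?K' \<le> ennreal (sqrt c / \<gamma>)"
    using regret_le_imp_bounded_by[OF N \<gamma> factorization K(1) regret c] \<gamma> c
    unfolding nehari_norm_def diff by (simp add: opnorm_le_iff)
qed

text \<open>Inverts the passage from \<open>K\<close> to \<open>K'\<close> in
  \<open>nehari_norm_causal_estimator\<close>: \<open>K\<close> is chosen so that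
  \<open>N \<odot> K \<odot> \<Delta>\<close> is \<open>K'\<close> plus the causal part.\<close>

lemma causal_estimator_of_nehari:
  assumes N: "canonical_factor N" and \<gamma>: "0 < \<gamma>"
    and factorization: "op_adj N \<odot> N = op_scale (1 / \<gamma>\<^sup>2)
        (op_id + op_scale (1 / \<gamma>\<^sup>2) (L \<odot> op_inv (op_id + op_adj H \<odot> H) \<odot> op_adj L))"
    and K': "causal K'" "nehari_norm (N \<odot> K0 \<odot> \<Delta>) K' \<le> 1"
  defines "K \<equiv> op_inv N \<odot> (K' + causal_part (N \<odot> K0 \<odot> \<Delta>)) \<odot> op_inv \<Delta>"
  shows "bounded_op K" "causal K" "regret H L K \<le> ennreal (\<gamma>\<^sup>2)"
proof -
  let ?X = "N \<odot> K0 \<odot> \<Delta>"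
  let ?Y = "K' + causal_part ?X"
  have N' [simp]: "bounded_op N" "bounded_op (op_inv N)" and causal_N: "causal (op_inv N)"
    and inv_N: "N \<odot> op_inv N = op_id" "op_inv N \<odot> N = op_id"
    using canonical_factorE[OF N] by blast+
  have diff: "anticausal_part ?X - K' = ?X - ?Y"
    using causal_part_add_anticausal_part[of ?X] by (simp add: algebra_simps)
  have le: "bounded_by (?X - ?Y) 1"
    using K'(2) opnorm_le_iff[of 1 "?X - ?Y"] by (simp add: nehari_norm_def diff)
  \<comment> \<open>\<open>K'\<close> and the causal part of \<open>?X\<close> may each be
    unbounded; their sum \<open>?Y\<close> is bounded as the difference of the bounded
    \<open>?X\<close> and \<open>?X - ?Y\<close>.\<close>
  then have "bounded_op (?X - ?Y)" by (auto simp: bounded_op_def)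
  then have "bounded_op (?X - (?X - ?Y))" by (rule bounded_op_diff[rotated]) simp
  then have Y [simp]: "bounded_op ?Y" by (simp add: algebra_simps)
  show K: "bounded_op K" by (simp add: K_def)
  show "causal K"
    unfolding K_def by (intro causal_op_mult causal_add causal_causal_part causal_N bounded_factor K')
  have "N \<odot> K \<odot> \<Delta> = ?Y"
    unfolding K_def
  proof (rule block_op_eqI)
    have "opf N (opf (op_inv N) x) = x" for x
      using inv_N by (simp flip: opf_mult add: opf_id)
    then show "opf (N \<odot> (op_inv N \<odot> ?Y \<odot> op_inv \<Delta>) \<odot> \<Delta>) x = opf ?Y x" for x
      by (simp add: opf_mult opf_inv_factor)
  qed simp_all
  then show "regret H L K \<le> ennreal (\<gamma>\<^sup>2)"
    using bounded_by_imp_regret_le[OF N \<gamma> factorization K] le by simp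
qed

end

theorem theorem2:
  fixes H :: "('t::linorder, 'k::{real_normed_field,euclidean_space}, 'y::finite, 'w::finite) block_op"
    and L :: "('t, 'k, 's::finite, 'w) block_op"
    and \<Delta> :: "('t, 'k, 'y, 'y) block_op"
    and Nabla :: "real \<Rightarrow> ('t, 'k, 's, 's) block_op"
  assumes "bounded_op H" and "strictly_causal H"
    and "bounded_op L" and "strictly_causal L"
    and "canonical_factor \<Delta>" and "\<Delta> \<odot> op_adj \<Delta> = op_id + H \<odot> op_adj H"
    and "\<And>\<gamma>. \<gamma> > 0 \<Longrightarrow> canonical_factor (Nabla \<gamma>)"
    and "\<And>\<gamma>. \<gamma> > 0 \<Longrightarrow> op_adj (Nabla \<gamma>) \<odot> Nabla \<gamma> =
      op_scale (1 / \<gamma>\<^sup>2)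
        (op_id + op_scale (1 / \<gamma>\<^sup>2) (L \<odot> op_inv (op_id + op_adj H \<odot> H) \<odot> op_adj L))"
  shows "(\<forall>\<gamma>>0. let X = Nabla \<gamma> \<odot> noncausal_estimator H L \<odot> \<Delta> in
        (\<exists>K'. is_arg_min (nehari_norm X) causal K') \<and>
        ((\<exists>K. bounded_op K \<and> causal K \<and> regret H L K \<le> ennreal (\<gamma>\<^sup>2))
          \<longleftrightarrow> (INF K'\<in>Collect causal. nehari_norm X K') \<le> 1))
    \<and> (\<forall>\<gamma>>0. let X = Nabla \<gamma> \<odot> noncausal_estimator H L \<odot> \<Delta> in
        \<forall>K'. is_arg_min (nehari_norm X) causal K' \<and> nehari_norm X K' = 1 \<longrightarrow>
          is_arg_min (regret H L) (\<lambda>K. bounded_op K \<and> causal K)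
            (op_inv (Nabla \<gamma>) \<odot> (K' + causal_part X) \<odot> op_inv \<Delta>))"
proof -
  interpret estimation_problem H L \<Delta>
    by unfold_locales fact+
  have X: "\<exists>K'. is_arg_min (nehari_norm X) causal K'" for X :: "('t, 'k, 's, 'y) block_op"
    unfolding nehari_norm_def by (rule causal_arg_min_opnorm_diff)
  have "(\<exists>K'. is_arg_min (nehari_norm X) causal K') \<and>
      ((\<exists>K. bounded_op K \<and> causal K \<and> regret H L K \<le> ennreal (\<gamma>\<^sup>2))
        \<longleftrightarrow> (INF K'\<in>Collect causal. nehari_norm X K') \<le> 1)"
    if \<gamma>: "\<gamma> > 0" and X_def: "X = Nabla \<gamma> \<odot> noncausal_estimator H L \<odot> \<Delta>" for \<gamma> X
  proof (intro conjI iffI)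
    note N = assms(7)[OF \<gamma>] \<gamma> assms(8)[OF \<gamma>]
    show "\<exists>K'. is_arg_min (nehari_norm X) causal K'" by (rule X)
    {
      assume "\<exists>K. bounded_op K \<and> causal K \<and> regret H L K \<le> ennreal (\<gamma>\<^sup>2)"
      then obtain K where K: "bounded_op K" "causal K" "regret H L K \<le> ennreal (\<gamma>\<^sup>2)" by blast
      \<comment> \<open>At \<open>c = \<gamma>\<^sup>2\<close> the constant
        \<open>sqrt c / \<gamma>\<close> is \<open>1\<close>.\<close>
      obtain K' where "causal K'" "nehari_norm X K' \<le> ennreal (sqrt (\<gamma>\<^sup>2) / \<gamma>)"
        using nehari_norm_causal_estimator[OF N K] \<gamma> unfolding X_def by auto
      then show "(INF K'\<in>Collect causal. nehari_norm X K') \<le> 1"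
        using \<gamma> by (intro INF_lower2[of K']) simp_all
    next
      assume le: "(INF K'\<in>Collect causal. nehari_norm X K') \<le> 1"
      \<comment> \<open>Since the infimum is attained, a bound on it yields an actual
        \<open>K'\<close> of norm at most \<open>1\<close>, from which \<open>K\<close> is
        built.\<close>
      obtain K' where K': "is_arg_min (nehari_norm X) causal K'" using X by blast
      then have "nehari_norm X K' \<le> (INF K'\<in>Collect causal. nehari_norm X K')"
        by (intro INF_greatest) (auto simp: is_arg_min_def not_less)
      then have "nehari_norm X K' \<le> 1" using le by (rule order.trans)
      moreover have "causal K'" using K' by (simp add: is_arg_min_def)
      ultimately show "\<exists>K. bounded_op K \<and> causal K \<and> regret H L K \<le> ennreal (\<gamma>\<^sup>2)"
        using causal_estimator_of_nehari[OF N] unfolding X_def by blast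
    }
  qed
  moreover have "is_arg_min (regret H L) (\<lambda>K. bounded_op K \<and> causal K)
        (op_inv (Nabla \<gamma>) \<odot> (K' + causal_part X) \<odot> op_inv \<Delta>)"
    if \<gamma>: "\<gamma> > 0" and X_def: "X = Nabla \<gamma> \<odot> noncausal_estimator H L \<odot> \<Delta>"
      and K': "is_arg_min (nehari_norm X) causal K'" and one: "nehari_norm X K' = 1" for \<gamma> X K'
  proof -
    note N = assms(7)[OF \<gamma>] \<gamma> assms(8)[OF \<gamma>]
    let ?K = "op_inv (Nabla \<gamma>) \<odot> (K' + causal_part X) \<odot> op_inv \<Delta>"
    have "causal K'" using K' by (simp add: is_arg_min_def)
    then have K: "bounded_op ?K" "causal ?K" "regret H L ?K \<le> ennreal (\<gamma>\<^sup>2)"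
      using causal_estimator_of_nehari[OF N, of K'] one unfolding X_def by simp_all
    have "\<not> regret H L K < regret H L ?K" if K2: "bounded_op K" "causal K" for K
    proof
      \<comment> \<open>A competitor of smaller regret would bring the Nehari value below its
        minimum \<open>1\<close>.\<close>
      assume "regret H L K < regret H L ?K"
      then have less: "regret H L K < ennreal (\<gamma>\<^sup>2)" using K(3) by (rule order.strict_trans2)
      then obtain r where r: "0 \<le> r" "regret H L K = ennreal r"
        by (cases "regret H L K" rule: ennreal_cases) auto
      \<comment> \<open>The midpoint lies strictly below \<open>\<gamma>\<^sup>2\<close> and is
        positive even for \<open>r = 0\<close>, as the Schur complement criterion requires.\<close>
      define c where "c = (r + \<gamma>\<^sup>2) / 2"
      have "r < \<gamma>\<^sup>2" using less r by (simp add: ennreal_less_iff)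
      then have c: "0 < c" "c < \<gamma>\<^sup>2" "r \<le> c" using r(1) by (simp_all add: c_def field_simps)
      have "regret H L K \<le> ennreal c" using r c by (simp add: ennreal_leI)
      then obtain K'' where K'': "causal K''" "nehari_norm X K'' \<le> ennreal (sqrt c / \<gamma>)"
        using nehari_norm_causal_estimator[OF N K2 _ c(1)] c(2) unfolding X_def by fastforce
      have "sqrt c < \<gamma>" using c(2) \<gamma> by (simp add: real_less_lsqrt)
      then have "ennreal (sqrt c / \<gamma>) < 1" using \<gamma> c(1) by (simp add: ennreal_less_one_iff)
      then have "nehari_norm X K'' < nehari_norm X K'"
        using K''(2) one by (simp add: order.strict_trans1)
      then show False using K' K''(1) by (auto simp: is_arg_min_def)
    qed
    then show ?thesis using K(1,2) by (auto simp: is_arg_min_def)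
  qed
  ultimately show ?thesis unfolding Let_def by blast
qed

end
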